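(* Let $T$ be a maximal dissipative operator in a complex Hilbert space $\mathcal H$, let $\mathfrak S_T=\{f\in\mathrm{dom}\,T:\mathrm{Im}(Tf,f)=0\}$ and let $Y_\lambda=(T-\lambda I)(T-\bar\lambda I)^{-1}$ be the Cayley transform of $T$ ($\mathrm{Im}\,\lambda>0$). (1) Suppose that $\mathfrak S_T\ne\{0\}$ and set $\mathfrak L=\mathcal H\ominus\mathfrak S_T$. For $\mathrm{Im}\,\mu\neq0$ let $\mathfrak N_\mu=\left((T-\bar\mu I)\mathfrak S_T\right)^\perp$ be the deficiency subspace of the Hermitian part of $T$, and let $M_\lambda=Y_\lambda\upharpoonright\mathfrak N_\lambda$, which is a contraction from $\mathfrak N_\lambda$ into $\mathfrak N_{\bar\lambda}$. Then the following are equivalent: (i) $T\in\mathbf D_{\rm sing}$; (ii) $\mathrm{ran}\,D_{M_\lambda^*}\cap(P_{\mathfrak N_{\bar\lambda}}-M_\lambda P_{\mathfrak N_\lambda})\mathfrak L=\{0\}$; (iii) $\mathrm{ran}\,D_{M_\lambda}\cap(P_{\mathfrak N_\lambda}-M_\lambda^*P_{\mathfrak N_{\bar\lambda}})\mathfrak L=\{0\}$. In particular: (a) if $\mathfrak S_T$ is dense in $\mathcal H$, then $T\in\mathbf D_{\rm sing}$; (b) if $\mathfrak S_T\ne\{0\}$, $\mathfrak S_T$ is non-dense in $\mathcal H$, and $\|M_\lambda\|<1$ for some $\lambda$ with $\mathrm{Im}\,\lambda>0$ (this is valid, for instance, if $\dim\mathfrak N_\lambda<\infty$), then $T\notin\mathbf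 D_{\rm sing}$. (2) If $T\in\mathbf D_{\rm sing}$, then $\mathfrak S_T=\mathrm{dom}\,T\cap\mathrm{dom}\,T^*$.
   Context: A linear operator $T$ in $\mathcal H$ is dissipative if $\mathrm{Im}(Tf,f)\ge 0$ for all $f\in\mathrm{dom}\,T$, and maximal dissipative if it is dissipative and has no proper dissipative (operator) extension in $\mathcal H$. A maximal dissipative operator is closed and densely defined, its resolvent set contains the open lower half-plane, and $Y_\lambda$ is a contraction on $\mathcal H$ for $\mathrm{Im}\,\lambda>0$. $T\in\mathbf D_{\rm sing}$ means that $T$ is maximal dissipative and for every $f\in\mathrm{dom}\,T$ there is a sequence $\{f_n\}\subset\mathrm{dom}\,T$ with $f_n\to f$ in $\mathcal H$ and $\mathrm{Im}(Tf_n,f_n)\to0$. $\mathfrak S_T$ is a linear manifold, called the Hermitian domain of $T$; the Hermitian part of $T$ is the closed symmetric operator $T\upharpoonright\mathfrak S_T$. $\mathcal H\ominus\mathfrak S_T$ is the orthogonal complement of $\mathfrak S_T$. For a contraction $Z$, $D_Z=(I-Z^*Z)^{1/2}$. $P_{\mathfrak K}$ is the orthogonal projection onto a closed subspace $\mathfrak K$. *)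

theory Defs
  imports "HOL-Analysis.Analysis"
begin

section \<open>Complex Hilbert spaces\<close>

text \<open>The inner product is linear in the first argument. The library's real inner product
  and norm are required to be the ones induced by it.\<close>

class chilbert_space = real_inner + complete_space +
  fixes scaleC :: "complex \<Rightarrow> 'a \<Rightarrow> 'a"  (infixr \<open>*\<^sub>C\<close> 75)
    and cinner :: "'a \<Rightarrow> 'a \<Rightarrow> complex"
  assumes scaleC_add_right: "c *\<^sub>C (x + y) = c *\<^sub>C x + c *\<^sub>C y"
    and scaleC_add_left: "(c + d) *\<^sub>C x = c *\<^sub>C x + d *\<^sub>C x"
    and scaleC_scaleC: "c *\<^sub>C d *\<^sub>C x = (c * d) *\<^sub>C x"
    and scaleR_scaleC: "r *\<^sub>R x = complex_of_real r *\<^sub>C x"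
    and cinner_commute: "cinner x y = cnj (cinner y x)"
    and cinner_add_left: "cinner (x + y) z = cinner x z + cinner y z"
    and cinner_scaleC_left: "cinner (c *\<^sub>C x) y = c * cinner x y"
    and inner_eq_Re_cinner: "inner x y = Re (cinner x y)"

global_interpretation complex_vector: vector_space "scaleC :: complex \<Rightarrow> 'a \<Rightarrow> 'a::chilbert_space"
proof
  show "1 *\<^sub>C x = x" for x :: 'a
    using scaleR_scaleC[of 1 x] by simp
qed (simp_all add: scaleC_add_right scaleC_add_left scaleC_scaleC)

definition corthogonal :: "'a::chilbert_space set \<Rightarrow> 'a set" where
  "corthogonal S = {x. \<forall>y\<in>S. cinner x y = 0}"

text \<open>The orthogonal projection \<open>P\<^sub>K\<close>; it is well defined when \<open>K\<close> is a closed subspace.\<close>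

definition cproj :: "'a::chilbert_space set \<Rightarrow> 'a \<Rightarrow> 'a" where
  "cproj K x = (THE y. y \<in> K \<and> x - y \<in> corthogonal K)"

definition cfinite_dim :: "'a::chilbert_space set \<Rightarrow> bool" where
  "cfinite_dim K \<longleftrightarrow> (\<exists>B. finite B \<and> complex_vector.span B = K)"

section \<open>Bounded operators between closed subspaces\<close>

text \<open>An operator is given by its domain \<open>D\<close>, a linear manifold, and a function whose values
  outside \<open>D\<close> are irrelevant.\<close>

definition linear_operator :: "'a::chilbert_space set \<Rightarrow> ('a \<Rightarrow> 'a) \<Rightarrow> bool" where
  "linear_operator D T \<longleftrightarrow> complex_vector.subspace D \<and>
     (\<forall>f\<in>D. \<forall>g\<in>D. T (f + g) = T f + T g) \<and> (\<forall>c. \<forall>f\<in>D. T (c *\<^sub>C f) = c *\<^sub>C T f)"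

definition contraction_between ::
    "'a::chilbert_space set \<Rightarrow> 'a set \<Rightarrow> ('a \<Rightarrow> 'a) \<Rightarrow> bool" where
  "contraction_between K K' Z \<longleftrightarrow>
     linear_operator K Z \<and> Z ` K \<subseteq> K' \<and> (\<forall>x\<in>K. norm (Z x) \<le> norm x)"

definition op_norm_on :: "'a::chilbert_space set \<Rightarrow> ('a \<Rightarrow> 'a) \<Rightarrow> real" where
  "op_norm_on K Z = (SUP x\<in>{x\<in>K. norm x \<le> 1}. norm (Z x))"

text \<open>The adjoint \<open>Z\<^sup>* : K' \<rightarrow> K\<close> of a bounded operator \<open>Z : K \<rightarrow> K'\<close> between closed subspaces.
  Like the square root below, it is \<^const>\<open>undefined\<close> off the subspace on which it acts.\<close>

definition cadjoint_on ::
    "'a::chilbert_space set \<Rightarrow> 'a set \<Rightarrow> ('a \<Rightarrow> 'a) \<Rightarrow> ('a \<Rightarrow> 'a)" where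
  "cadjoint_on K K' Z =
     restrict (\<lambda>y. THE z. z \<in> K \<and> (\<forall>x\<in>K. cinner (Z x) y = cinner x z)) K'"

definition nonneg_operator :: "'a::chilbert_space set \<Rightarrow> ('a \<Rightarrow> 'a) \<Rightarrow> bool" where
  "nonneg_operator K S \<longleftrightarrow>
     linear_operator K S \<and> S ` K \<subseteq> K \<and> (\<exists>C. \<forall>x\<in>K. norm (S x) \<le> C * norm x) \<and>
     (\<forall>x\<in>K. \<forall>y\<in>K. cinner (S x) y = cinner x (S y)) \<and> (\<forall>x\<in>K. Re (cinner (S x) x) \<ge> 0)"

text \<open>\<open>A\<^sup>1\<^sup>/\<^sup>2\<close> for a bounded nonnegative operator \<open>A\<close> on a closed subspace \<open>K\<close>.\<close>

definition nonneg_sqrt :: "'a::chilbert_space set \<Rightarrow> ('a \<Rightarrow> 'a) \<Rightarrow> ('a \<Rightarrow> 'a)" where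
  "nonneg_sqrt K A =
     (THE S. S \<in> extensional K \<and> nonneg_operator K S \<and> (\<forall>x\<in>K. S (S x) = A x))"

text \<open>\<open>D\<^sub>Z = (I - Z\<^sup>*Z)\<^sup>1\<^sup>/\<^sup>2\<close>, acting on \<open>K\<close>, for a contraction \<open>Z : K \<rightarrow> K'\<close>.\<close>

definition defect_operator ::
    "'a::chilbert_space set \<Rightarrow> 'a set \<Rightarrow> ('a \<Rightarrow> 'a) \<Rightarrow> ('a \<Rightarrow> 'a)" where
  "defect_operator K K' Z = nonneg_sqrt K (\<lambda>x. x - cadjoint_on K K' Z (Z x))"

section \<open>Dissipative operators\<close>

definition dissipative :: "'a::chilbert_space set \<Rightarrow> ('a \<Rightarrow> 'a) \<Rightarrow> bool" where
  "dissipative D T \<longleftrightarrow> linear_operator D T \<and> (\<forall>f\<in>D. Im (cinner (T f) f) \<ge> 0)"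

definition maximal_dissipative :: "'a::chilbert_space set \<Rightarrow> ('a \<Rightarrow> 'a) \<Rightarrow> bool" where
  "maximal_dissipative D T \<longleftrightarrow> dissipative D T \<and>
     \<not> (\<exists>D' T'. D \<subset> D' \<and> (\<forall>f\<in>D. T' f = T f) \<and> dissipative D' T')"

text \<open>Density of the domain does not follow from \<^const>\<open>maximal_dissipative\<close>, which only excludes
  single-valued extensions: let \<open>H = G \<oplus> \<complex>e\<close>, let \<open>T\<^sub>0\<close> be maximal dissipative and
  densely defined in \<open>G\<close>, and let \<open>\<phi>\<close> be a linear functional on \<open>dom T\<^sub>0\<close> that is discontinuous
  in the graph norm; then \<open>f \<mapsto> T\<^sub>0 f + \<phi>(f) e\<close> on \<open>dom T\<^sub>0\<close> is maximal in this sense. For densely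
  defined operators the usual consequences hold (closedness, and the open lower half-plane
  lies in the resolvent set).\<close>

definition densely_defined :: "'a::chilbert_space set \<Rightarrow> bool" where
  "densely_defined D \<longleftrightarrow> closure D = UNIV"

text \<open>The class \<open>\<^bold>D\<^sub>s\<^sub>i\<^sub>n\<^sub>g\<close>.\<close>

definition D_sing :: "'a::chilbert_space set \<Rightarrow> ('a \<Rightarrow> 'a) \<Rightarrow> bool" where
  "D_sing D T \<longleftrightarrow> maximal_dissipative D T \<and>
     (\<forall>f\<in>D. \<exists>s. (\<forall>n. s n \<in> D) \<and> s \<longlonglongrightarrow> f \<and> (\<lambda>n. Im (cinner (T (s n)) (s n))) \<longlonglongrightarrow> 0)"

definition hermitian_domain :: "'a::chilbert_space set \<Rightarrow> ('a \<Rightarrow> 'a) \<Rightarrow> 'a set" where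
  "hermitian_domain D T = {f\<in>D. Im (cinner (T f) f) = 0}"

definition adjoint_domain :: "'a::chilbert_space set \<Rightarrow> ('a \<Rightarrow> 'a) \<Rightarrow> 'a set" where
  "adjoint_domain D T = {g. \<exists>h. \<forall>f\<in>D. cinner (T f) g = cinner f h}"

definition cayley :: "'a::chilbert_space set \<Rightarrow> ('a \<Rightarrow> 'a) \<Rightarrow> complex \<Rightarrow> 'a \<Rightarrow> 'a" where
  "cayley D T \<mu> x = (let f = inv_into D (\<lambda>f. T f - cnj \<mu> *\<^sub>C f) x in T f - \<mu> *\<^sub>C f)"

definition deficiency_subspace ::
    "'a::chilbert_space set \<Rightarrow> ('a \<Rightarrow> 'a) \<Rightarrow> complex \<Rightarrow> 'a set" where
  "deficiency_subspace D T \<mu> =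
     corthogonal ((\<lambda>f. T f - cnj \<mu> *\<^sub>C f) ` hermitian_domain D T)"

text \<open>\<open>M\<^sub>\<mu>\<close>, the restriction of the Cayley transform \<open>Y\<^sub>\<mu>\<close> to \<open>N\<^sub>\<mu>\<close>.\<close>

definition M_op :: "'a::chilbert_space set \<Rightarrow> ('a \<Rightarrow> 'a) \<Rightarrow> complex \<Rightarrow> 'a \<Rightarrow> 'a" where
  "M_op D T \<mu> = restrict (cayley D T \<mu>) (deficiency_subspace D T \<mu>)"

end

theory Submission
  imports Defs
begin

text \<open>Let \<open>S\<close> be the Hermitian domain, \<open>Im \<mu> > 0\<close>, \<open>Y\<close> the Cayley transform and \<open>R = (T - cnj \<mu>) S\<close>.
  Everything rests on the identity \<open>\<parallel>x\<parallel>\<^sup>2 - \<parallel>Y x\<parallel>\<^sup>2 = 4 Im \<mu> Im (T f, f)\<close> for \<open>x = (T - cnj \<mu>) f\<close>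
  together with \<open>(I - Y) x = (\<mu> - cnj \<mu>) f\<close>. The identity shows that \<open>R\<close> is the closed subspace on
  which \<open>Y\<close> is isometric, so \<open>H = R \<oplus> N\<close>, \<open>Y\<close> maps \<open>N\<close> into \<open>N'\<close>, and the form \<open>Im (T f, f)\<close> is a
  multiple of \<open>\<parallel>D\<^sub>M P\<^sub>N x\<parallel>\<^sup>2\<close>. Two facts behind this, that \<open>T\<close> is closed and that \<open>T - cnj \<mu>\<close>
  is onto, come from maximality, applied to the extension of \<open>T\<close> by one vector (a limit of domain
  vectors, or a vector orthogonal to the range), and from density, which excludes that the
  closure of \<open>T\<close> is multivalued (\<open>closed_graph\<close>, \<open>range_shifted\<close>).

  Consequently \<open>T\<close> is singular if and only if the closure of the graph \<open>{((I - Y) x, D\<^sub>M P\<^sub>N x)}\<close>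
  in \<open>H \<times> H\<close> contains \<open>(f, 0)\<close> for all \<open>f\<close> in the domain. Computing the orthogonal complement of
  this graph turns this into the condition on \<open>ran D\<^sub>M\<close>, once one knows that \<open>P\<^sub>N - M\<^sup>* P\<^sub>N\<^sub>'\<close> agrees with
  \<open>(I - Y)\<^sup>*\<close> on \<open>L\<close> and therefore, the range of \<open>I - Y\<close> being dense, is injective there
  (\<open>cinner_adj_part\<close>, \<open>D_sing_iff_defect_range\<close>).

  The two range conditions are equivalent vector by vector (\<open>defect_range_transfer\<close>): with
  \<open>a = P\<^sub>N u\<close> and \<open>b = P\<^sub>N\<^sub>' u\<close>, the relation \<open>a - M\<^sup>* b = D\<^sub>M v\<close> implies \<open>b - M a = D (D b - M v)\<close> with
  \<open>D\<close> the defect operator of \<open>M\<^sup>*\<close>, because \<open>M D\<^sub>M = D M\<close>. The square roots and this intertwining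
  relation are obtained from an iteration that is dominated by a scalar sequence.

  If \<open>\<parallel>M\<parallel> < 1\<close>, then \<open>D\<^sub>M\<close> is bounded below, and testing the sequences in the definition of singularity
  against \<open>L\<close> yields \<open>L = {0}\<close>. For finite-dimensional \<open>N\<close> the norm of \<open>M\<close> is attained on a compact ball,
  where it is less than \<open>1\<close> because \<open>N \<inter> R = {0}\<close>. Finally, for singular \<open>T\<close> the equality
  \<open>S = dom T \<inter> dom T\<^sup>*\<close> follows from the Cauchy--Schwarz inequality for the form \<open>Im (T f, f)\<close>
  (\<open>form_Cauchy_Schwarz\<close>, \<open>hermitian_eq_if_D_sing\<close>).\<close>

section \<open>Complex inner product spaces\<close>

lemma cinner_add_right: "cinner x (y + z) = cinner x y + cinner x z"
  by (metis cinner_add_left cinner_commute complex_cnj_add)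

lemma cinner_scaleC_right: "cinner x (c *\<^sub>C y) = cnj c * cinner x y"
  by (metis cinner_scaleC_left cinner_commute complex_cnj_mult)

lemma cinner_zero_left [simp]: "cinner 0 x = 0"
  using cinner_add_left[of 0 0 x] by simp

lemma cinner_zero_right [simp]: "cinner x 0 = 0"
  using cinner_add_right[of x 0 0] by simp

lemma cinner_diff_left: "cinner (x - y) z = cinner x z - cinner y z"
  using cinner_add_left[of "x - y" y z] by simp

lemma cinner_diff_right: "cinner x (y - z) = cinner x y - cinner x z"
  using cinner_add_right[of x "y - z" z] by simp

lemmas cinner_expand = cinner_add_left cinner_add_right cinner_diff_left cinner_diff_right
  cinner_scaleC_left cinner_scaleC_right

lemma cinner_self: "cinner x x = complex_of_real ((norm x)\<^sup>2)"
proof -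
  have "Im (cinner x x) = 0"
    using cinner_commute[of x x] by (metis cnj.simps(2) equal_neg_zero)
  then show ?thesis
    by (simp add: complex_eq_iff flip: inner_eq_Re_cinner power2_norm_eq_inner)
qed

lemma norm_scaleC: "norm (c *\<^sub>C x) = cmod c * norm x"
proof -
  have "complex_of_real ((norm (c *\<^sub>C x))\<^sup>2) = (c * cnj c) * complex_of_real ((norm x)\<^sup>2)"
    by (simp only: flip: cinner_self) (simp add: cinner_expand)
  also have "c * cnj c = complex_of_real ((cmod c)\<^sup>2)"
    by (rule complex_norm_square[symmetric])
  finally have "(norm (c *\<^sub>C x))\<^sup>2 = (cmod c * norm x)\<^sup>2"
    by (metis of_real_eq_iff of_real_mult power_mult_distrib)
  then show ?thesis
    by (simp add: power2_eq_iff_nonneg)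
qed

lemma norm_cinner_le: "cmod (cinner x y) \<le> norm x * norm y"
proof -
  define c where "c = cnj (sgn (cinner x y))"
  have "cmod c \<le> 1"
    by (simp add: c_def norm_sgn)
  have "c * cinner x y = complex_of_real (cmod (cinner x y))"
    by (cases "cinner x y = 0")
      (auto simp: c_def sgn_eq complex_norm_square[symmetric] power2_eq_square
         mult.commute[of "cnj _"])
  then have "cmod (cinner x y) = inner (c *\<^sub>C x) y"
    by (simp add: inner_eq_Re_cinner cinner_scaleC_left)
  also have "\<dots> \<le> norm (c *\<^sub>C x) * norm y"
    by (rule norm_cauchy_schwarz)
  also have "\<dots> \<le> norm x * norm y"
    using \<open>cmod c \<le> 1\<close> by (simp add: norm_scaleC mult_left_le_one_le mult_right_mono)
  finally show ?thesis .
qed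

lemma bounded_bilinear_cinner: "bounded_bilinear cinner"
proof
  show "\<exists>K. \<forall>a b. cmod (cinner a b) \<le> norm a * norm b * K"
    using norm_cinner_le by (metis mult.right_neutral)
qed (simp_all add: cinner_expand scaleR_scaleC scaleR_conv_of_real)

lemma bounded_bilinear_scaleC: "bounded_bilinear scaleC"
proof
  show "\<exists>K. \<forall>a b. norm (a *\<^sub>C b) \<le> norm a * norm b * K"
    using norm_scaleC by (metis mult.right_neutral order_refl)
qed (simp_all add: scaleC_add_left scaleC_add_right scaleR_scaleC scaleC_scaleC
      scaleR_conv_of_real mult.commute)

lemmas tendsto_cinner [tendsto_intros] = bounded_bilinear.tendsto[OF bounded_bilinear_cinner]
lemmas tendsto_scaleC [tendsto_intros] = bounded_bilinear.tendsto[OF bounded_bilinear_scaleC]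
lemmas continuous_on_cinner [continuous_intros] =
  bounded_bilinear.continuous_on[OF bounded_bilinear_cinner]
lemmas continuous_on_scaleC [continuous_intros] =
  bounded_bilinear.continuous_on[OF bounded_bilinear_scaleC]

lemma scaleR_scaleC_commute: "r *\<^sub>R c *\<^sub>C (x::'a::chilbert_space) = c *\<^sub>C r *\<^sub>R x"
  by (simp add: scaleR_scaleC scaleC_scaleC mult.commute)

lemma tendsto_zero_if_norm_square:
  fixes f :: "'b \<Rightarrow> 'a::real_normed_vector"
  assumes "((\<lambda>x. (norm (f x))\<^sup>2) \<longlongrightarrow> 0) F"
  shows "(f \<longlongrightarrow> 0) F"
  by (rule tendsto_norm_zero_cancel) (use tendsto_real_sqrt[OF assms] in simp)

lemma csubspace_imp_subspace:
  "complex_vector.subspace K \<Longrightarrow> subspace K"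
  by (auto simp: subspace_def complex_vector.subspace_def scaleR_scaleC)

text \<open>Since \<open>K\<close> admits multiplication by \<open>\<i>\<close>, real orthogonality to \<open>K\<close> is complex
  orthogonality; this is what lets the real Riesz lemma below serve the complex theory.\<close>

lemma cinner_eq_if_inner_eq:
  assumes K: "complex_vector.subspace K" and lin: "linear_operator K Z"
    and eq: "\<And>x. x \<in> K \<Longrightarrow> inner (Z x) y = inner x z" and x: "x \<in> K"
  shows "cinner (Z x) y = cinner x z"
proof -
  have "\<i> *\<^sub>C x \<in> K"
    using K x by (simp add: complex_vector.subspace_scale)
  then have "inner (\<i> *\<^sub>C Z x) y = inner (\<i> *\<^sub>C x) z"
    using eq[of "\<i> *\<^sub>C x"] lin x by (simp add: linear_operator_def)
  then have "Im (cinner (Z x) y) = Im (cinner x z)"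
    by (simp add: inner_eq_Re_cinner cinner_scaleC_left)
  then show ?thesis
    using eq[OF x] by (simp add: complex_eq_iff inner_eq_Re_cinner)
qed

lemma linear_operator_id: "complex_vector.subspace K \<Longrightarrow> linear_operator K (\<lambda>x. x)"
  by (simp add: linear_operator_def)

lemma linear_operatorD:
  assumes "linear_operator K Z"
  shows "complex_vector.subspace K" "\<And>x y. x \<in> K \<Longrightarrow> y \<in> K \<Longrightarrow> Z (x + y) = Z x + Z y"
    "\<And>c x. x \<in> K \<Longrightarrow> Z (c *\<^sub>C x) = c *\<^sub>C Z x" "\<And>r x. x \<in> K \<Longrightarrow> Z (r *\<^sub>R x) = r *\<^sub>R Z x"
  using assms by (auto simp: linear_operator_def scaleR_scaleC)

lemma linear_operatorI:
  assumes "complex_vector.subspace K" "\<And>x y. x \<in> K \<Longrightarrow> y \<in> K \<Longrightarrow> Z (x + y) = Z x + Z y"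
    "\<And>c x. x \<in> K \<Longrightarrow> Z (c *\<^sub>C x) = c *\<^sub>C Z x"
  shows "linear_operator K Z"
  using assms by (auto simp: linear_operator_def)

lemma linear_operator_diff:
  assumes "linear_operator K Z" "x \<in> K" "y \<in> K"
  shows "Z (x - y) = Z x - Z y"
proof -
  have "(-1) *\<^sub>C y \<in> K" "Z ((-1) *\<^sub>C y) = (-1) *\<^sub>C Z y"
    using assms complex_vector.subspace_scale[of K y "-1"] unfolding linear_operator_def by blast+
  then have "Z (x + (-1) *\<^sub>C y) = Z x + (-1) *\<^sub>C Z y"
    using assms unfolding linear_operator_def by metis
  then show ?thesis by simp
qed

lemma linear_operator_zero: "linear_operator K Z \<Longrightarrow> Z 0 = 0"
  using linear_operator_diff[of K Z 0 0]
  by (simp add: linear_operator_def complex_vector.subspace_0)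

lemma csubspace_image:
  assumes Z: "linear_operator K Z" and V: "complex_vector.subspace V" "V \<subseteq> K"
  shows "complex_vector.subspace (Z ` V)"
  unfolding complex_vector.subspace_def
proof (intro conjI ballI allI)
  note lin = linear_operatorD[OF Z]
  show "0 \<in> Z ` V"
    using complex_vector.subspace_0[OF V(1)] linear_operator_zero[OF Z] by (intro image_eqI) auto
  show "x + y \<in> Z ` V" if "x \<in> Z ` V" "y \<in> Z ` V" for x y
  proof -
    obtain f g where fg: "f \<in> V" "g \<in> V" "x = Z f" "y = Z g"
      using \<open>x \<in> Z ` V\<close> \<open>y \<in> Z ` V\<close> by blast
    then have "x + y = Z (f + g)"
      using lin(2)[of f g] V(2) by (simp add: subset_iff)
    then show ?thesis
      using complex_vector.subspace_add[OF V(1) fg(1,2)] by blast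
  qed
  show "c *\<^sub>C x \<in> Z ` V" if "x \<in> Z ` V" for c x
  proof -
    obtain f where f: "f \<in> V" "x = Z f"
      using \<open>x \<in> Z ` V\<close> by blast
    then have "c *\<^sub>C x = Z (c *\<^sub>C f)"
      using lin(3)[of f c] V(2) by (simp add: subset_iff)
    then show ?thesis
      using complex_vector.subspace_scale[OF V(1) f(1)] by blast
  qed
qed

lemma csubspace_corthogonal: "complex_vector.subspace (corthogonal S)"
  by (auto simp: corthogonal_def complex_vector.subspace_def cinner_expand)

lemma closed_corthogonal: "closed (corthogonal S)"
proof -
  have "corthogonal S = (\<Inter>y\<in>S. {x. cinner x y = 0})"
    by (auto simp: corthogonal_def)
  also have "closed \<dots>"
    by (intro closed_INT ballI closed_Collect_eq continuous_intros)
  finally show ?thesis .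
qed

lemma corthogonal_self: "x \<in> K \<Longrightarrow> x \<in> corthogonal K \<Longrightarrow> x = 0"
  using cinner_self[of x] by (auto simp: corthogonal_def)

section \<open>Riesz representation, projections and adjoints\<close>

lemma quadratic_nonneg_discriminant:
  fixes a b c :: real
  assumes nonneg: "\<And>t. 0 \<le> a + 2 * t * b + t\<^sup>2 * c" and "0 \<le> c"
  shows "b\<^sup>2 \<le> a * c"
proof (cases "c = 0")
  case True
  have "b = 0"
  proof (rule ccontr)
    assume "b \<noteq> 0"
    then show False
      using nonneg[of "- (a + 1) / (2 * b)"] True by (simp add: field_simps)
  qed
  with True show ?thesis by simp
next
  case False
  then have "0 \<le> c * (a + 2 * (- b / c) * b + (- b / c)\<^sup>2 * c)"
    using nonneg[of "- b / c"] \<open>0 \<le> c\<close> by (intro mult_nonneg_nonneg)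
  also have "\<dots> = a * c - b\<^sup>2"
    using False by (simp add: field_simps power2_eq_square)
  finally show ?thesis by simp
qed

text \<open>The representing vector is the minimiser of \<open>\<parallel>x\<parallel>\<^sup>2 - 2 \<phi> x\<close>: the parallelogram law makes
  every minimising sequence Cauchy, and the first variation at the minimum is the claim.\<close>

lemma riesz_representation:
  fixes K :: "'a::{real_inner, complete_space} set" and \<phi> :: "'a \<Rightarrow> real"
  assumes K: "subspace K" "closed K"
    and add: "\<And>x y. x \<in> K \<Longrightarrow> y \<in> K \<Longrightarrow> \<phi> (x + y) = \<phi> x + \<phi> y"
    and scale: "\<And>r x. x \<in> K \<Longrightarrow> \<phi> (r *\<^sub>R x) = r * \<phi> x"
    and bound: "\<And>x. x \<in> K \<Longrightarrow> \<bar>\<phi> x\<bar> \<le> C * norm x"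
  shows "\<exists>z\<in>K. \<forall>x\<in>K. \<phi> x = inner x z"
proof -
  define J where "J x = (norm x)\<^sup>2 - 2 * \<phi> x" for x
  have "- C\<^sup>2 \<le> J x" if "x \<in> K" for x
  proof -
    have "0 \<le> (norm x - C)\<^sup>2" by simp
    then show ?thesis
      using bound[OF that] unfolding J_def power2_eq_square by (simp add: algebra_simps)
  qed
  then have bdd: "bdd_below (J ` K)"
    by (rule bdd_belowI2)
  have "0 \<in> K"
    using K(1) by (rule subspace_0)
  define I where "I = Inf (J ` K)"
  have I_le: "I \<le> J x" if "x \<in> K" for x
    unfolding I_def using bdd that by (rule cINF_lower)
  have "\<exists>x\<in>K. J x < I + 1 / real (Suc n)" for n
    using cInf_lessD[of "J ` K" "I + 1 / real (Suc n)"] \<open>0 \<in> K\<close> I_def by auto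
  then obtain s where s: "\<And>n. s n \<in> K" "\<And>n. J (s n) < I + 1 / real (Suc n)"
    by metis
  \<comment> \<open>The parallelogram law, with the midpoint of \<open>x\<close> and \<open>y\<close> as competitor.\<close>
  have gap: "(norm (x - y))\<^sup>2 \<le> 2 * (J x - I) + 2 * (J y - I)" if "x \<in> K" "y \<in> K" for x y
  proof -
    have xy: "x + y \<in> K" "(1/2) *\<^sub>R (x + y) \<in> K"
      using K(1) that by (simp_all add: subspace_add subspace_scale)
    have "4 * I \<le> 4 * J ((1/2) *\<^sub>R (x + y))"
      using I_le[OF xy(2)] by simp
    also have "\<dots> = (norm (x + y))\<^sup>2 - 4 * (\<phi> x + \<phi> y)"
      unfolding J_def by (simp add: scale[OF xy(1)] add[OF that] power_divide add_divide_distrib)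
    finally show ?thesis
      by (simp add: J_def power2_norm_eq_inner inner_diff inner_add inner_commute[of y x])
  qed
  have "Cauchy s"
  proof (rule metric_CauchyI)
    fix e :: real assume "0 < e"
    then obtain n0 where n0: "4 / e\<^sup>2 < real (Suc n0)"
      by (metis reals_Archimedean2 less_SucI of_nat_less_iff order.strict_trans lessI)
    have "dist (s m) (s n) < e" if "m \<ge> n0" "n \<ge> n0" for m n
    proof -
      define d where "d = 1 / real (Suc n0)"
      have near: "J (s k) < I + d" if "k \<ge> n0" for k
        by (rule order.strict_trans2[OF s(2)[of k]]) (use that in \<open>simp add: d_def frac_le\<close>)
      have "(norm (s m - s n))\<^sup>2 < 4 * d"
        using gap[OF s(1) s(1), of m n] near[OF that(1)] near[OF that(2)] by argo
      also have "4 * d = 4 / real (Suc n0)"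
        by (simp add: d_def)
      also have "\<dots> < e\<^sup>2"
        using n0 \<open>0 < e\<close> by (simp add: field_simps)
      finally show ?thesis
        using \<open>0 < e\<close> by (simp add: dist_norm power2_less_imp_less)
    qed
    then show "\<exists>n0. \<forall>m\<ge>n0. \<forall>n\<ge>n0. dist (s m) (s n) < e" by blast
  qed
  then obtain z where z: "s \<longlonglongrightarrow> z"
    using Cauchy_convergent convergent_def by blast
  then have zK: "z \<in> K"
    using K(2) s(1) closed_sequentially by blast
  have "(\<lambda>n. \<phi> (s n)) \<longlonglongrightarrow> \<phi> z"
  proof (rule LIM_zero_cancel)
    have "(\<lambda>n. C * norm (s n - z)) \<longlonglongrightarrow> C * norm (z - z)"
      by (intro tendsto_intros z)
    then have lim: "(\<lambda>n. C * norm (s n - z)) \<longlonglongrightarrow> 0" by simp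
    have "\<phi> (s n) - \<phi> z = \<phi> (s n - z)" for n
      using add[of "s n - z" z] s(1) zK K(1) by (simp add: subspace_diff)
    then have "\<bar>\<phi> (s n) - \<phi> z\<bar> \<le> C * norm (s n - z)" for n
      using bound[of "s n - z"] s(1) zK K(1) by (simp add: subspace_diff)
    then show "(\<lambda>n. \<phi> (s n) - \<phi> z) \<longlonglongrightarrow> 0"
      by (intro Lim_null_comparison[OF _ lim]) auto
  qed
  then have "(\<lambda>n. J (s n)) \<longlonglongrightarrow> J z"
    unfolding J_def by (intro tendsto_intros z)
  moreover have "(\<lambda>n. I + 1 / real (Suc n)) \<longlonglongrightarrow> I + 0"
    by (intro tendsto_intros LIMSEQ_Suc[OF lim_1_over_n])
  ultimately have "J z \<le> I"
    using s(2) by (intro LIMSEQ_le[of "\<lambda>n. J (s n)" _ "\<lambda>n. I + 1 / real (Suc n)"])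
      (auto intro: less_imp_le)
  have "\<phi> x = inner x z" if "x \<in> K" for x
  proof -
    have "0 \<le> 0 + 2 * t * (inner x z - \<phi> x) + t\<^sup>2 * (norm x)\<^sup>2" for t
    proof -
      have tx: "t *\<^sub>R x \<in> K" "z + t *\<^sub>R x \<in> K"
        using K(1) that zK by (simp_all add: subspace_add subspace_scale)
      have "J z \<le> J (z + t *\<^sub>R x)"
        using I_le[OF tx(2)] \<open>J z \<le> I\<close> by simp
      then show ?thesis
        by (simp add: J_def add[OF zK tx(1)] scale[OF that] power2_norm_eq_inner inner_add
            inner_commute[of z x]) (simp add: algebra_simps power2_eq_square)
    qed
    then have "(inner x z - \<phi> x)\<^sup>2 \<le> 0 * (norm x)\<^sup>2"
      by (rule quadratic_nonneg_discriminant) simp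
    then show ?thesis by simp
  qed
  with zK show ?thesis by blast
qed

lemma orthogonal_projection_exists:
  fixes K :: "'a::{real_inner, complete_space} set"
  assumes "subspace K" "closed K"
  shows "\<exists>z\<in>K. \<forall>x\<in>K. inner x (y - z) = 0"
proof -
  have "\<exists>z\<in>K. \<forall>x\<in>K. inner x y = inner x z"
    by (rule riesz_representation[OF assms, where C = "norm y"])
      (auto simp: inner_add_left mult.commute[of "norm y"] Cauchy_Schwarz_ineq2)
  then show ?thesis
    by (auto simp: inner_diff_right)
qed

lemma subspace_closure:
  fixes G :: "'a::real_normed_vector set"
  assumes "subspace G"
  shows "subspace (closure G)"
proof (rule subspaceI)
  show "0 \<in> closure G"
    using subspace_0[OF assms] closure_subset by blast
  show "x + y \<in> closure G" if xy: "x \<in> closure G" "y \<in> closure G" for x y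
  proof -
    obtain s t where "\<forall>n. s n \<in> G" "s \<longlonglongrightarrow> x" "\<forall>n. t n \<in> G" "t \<longlonglongrightarrow> y"
      using xy unfolding closure_sequential by blast
    then have "\<forall>n. s n + t n \<in> G" "(\<lambda>n. s n + t n) \<longlonglongrightarrow> x + y"
      by (simp_all add: subspace_add[OF assms] tendsto_add)
    then show ?thesis
      unfolding closure_sequential by (intro exI[of _ "\<lambda>n. s n + t n"]) blast
  qed
  show "c *\<^sub>R x \<in> closure G" if x: "x \<in> closure G" for c x
  proof -
    obtain s where "\<forall>n. s n \<in> G" "s \<longlonglongrightarrow> x"
      using x unfolding closure_sequential by blast
    then have "\<forall>n. c *\<^sub>R s n \<in> G" "(\<lambda>n. c *\<^sub>R s n) \<longlonglongrightarrow> c *\<^sub>R x"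
      by (simp_all add: subspace_scale[OF assms] tendsto_scaleR)
    then show ?thesis
      unfolding closure_sequential by (intro exI[of _ "\<lambda>n. c *\<^sub>R s n"]) blast
  qed
qed

text \<open>Stated for real Hilbert spaces, so that it also applies to the product of two complex ones.\<close>

lemma mem_closure_if_orthogonal:
  fixes G :: "'a::{real_inner, complete_space} set"
  assumes G: "subspace G"
    and p: "\<And>w. (\<And>x. x \<in> G \<Longrightarrow> inner x w = 0) \<Longrightarrow> inner p w = 0"
  shows "p \<in> closure G"
proof -
  obtain q where q: "q \<in> closure G" "\<And>x. x \<in> closure G \<Longrightarrow> inner x (p - q) = 0"
    using orthogonal_projection_exists[of "closure G" p] subspace_closure[OF G] by auto
  have "inner p (p - q) = 0"
    using q(2) closure_subset by (intro p) blast
  with q have "inner (p - q) (p - q) = 0"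
    by (simp add: inner_diff_left)
  with q(1) show ?thesis by simp
qed

lemma cproj_eqI:
  assumes "complex_vector.subspace K" "y \<in> K" "x - y \<in> corthogonal K"
  shows "cproj K x = y"
  unfolding cproj_def
proof (rule the_equality)
  fix z assume z: "z \<in> K \<and> x - z \<in> corthogonal K"
  have "(x - y) - (x - z) \<in> corthogonal K"
    using z assms(3) csubspace_corthogonal complex_vector.subspace_diff by blast
  then have "z - y \<in> corthogonal K" by simp
  moreover have "z - y \<in> K"
    using z assms complex_vector.subspace_diff by blast
  ultimately show "z = y"
    using corthogonal_self by fastforce
qed (use assms in blast)

lemma
  assumes K: "complex_vector.subspace K" "closed K"
  shows cproj_mem: "cproj K x \<in> K"
    and cproj_orthogonal: "x - cproj K x \<in> corthogonal K"
proof -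
  obtain z where z: "z \<in> K" "\<And>y. y \<in> K \<Longrightarrow> inner y (x - z) = 0"
    using orthogonal_projection_exists[OF csubspace_imp_subspace[OF K(1)] K(2)] by blast
  have "cinner y (x - z) = cinner y 0" if "y \<in> K" for y
    using cinner_eq_if_inner_eq[OF K(1) linear_operator_id[OF K(1)], of "x - z" 0 y] z(2) that
    by simp
  then have "x - z \<in> corthogonal K"
    by (auto simp: corthogonal_def) (metis cinner_commute complex_cnj_zero)
  then show "cproj K x \<in> K" "x - cproj K x \<in> corthogonal K"
    using cproj_eqI[OF K(1) z(1)] z(1) by simp_all
qed

lemma cproj_cinner:
  assumes K: "complex_vector.subspace K" "closed K" and "y \<in> K"
  shows "cinner (cproj K x) y = cinner x y" "cinner y (cproj K x) = cinner y x"
proof -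
  show "cinner (cproj K x) y = cinner x y"
    using cproj_orthogonal[OF K, of x] \<open>y \<in> K\<close> by (simp add: corthogonal_def cinner_expand)
  then show "cinner y (cproj K x) = cinner y x"
    by (metis cinner_commute)
qed

lemma linear_operator_cproj:
  assumes K: "complex_vector.subspace K" "closed K"
  shows "linear_operator UNIV (cproj K)"
proof -
  note mem = cproj_mem[OF K] and orth = cproj_orthogonal[OF K]
  have "(f + g) - (cproj K f + cproj K g) \<in> corthogonal K" for f g
    using complex_vector.subspace_add[OF csubspace_corthogonal orth[of f] orth[of g]]
    by (simp add: algebra_simps)
  then have "cproj K (f + g) = cproj K f + cproj K g" for f g
    by (intro cproj_eqI[OF K(1)] complex_vector.subspace_add[OF K(1)] mem)
  moreover have "c *\<^sub>C f - c *\<^sub>C cproj K f \<in> corthogonal K" for c f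
    using complex_vector.subspace_scale[OF csubspace_corthogonal orth[of f], of c]
    by (simp add: complex_vector.scale_right_diff_distrib)
  then have "cproj K (c *\<^sub>C f) = c *\<^sub>C cproj K f" for c f
    by (intro cproj_eqI[OF K(1)] complex_vector.subspace_scale[OF K(1)] mem)
  ultimately show ?thesis
    by (simp add: linear_operator_def complex_vector.subspace_UNIV)
qed

lemma contraction_betweenD:
  assumes "contraction_between K K' Z"
  shows "complex_vector.subspace K" "linear_operator K Z"
    "\<And>x. x \<in> K \<Longrightarrow> Z x \<in> K'" "\<And>x. x \<in> K \<Longrightarrow> norm (Z x) \<le> norm x"
  using assms by (auto simp: contraction_between_def linear_operator_def)

lemma cadjoint_on_eqI:
  assumes K: "complex_vector.subspace K" and "y \<in> K'" "z \<in> K"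
    and eq: "\<And>x. x \<in> K \<Longrightarrow> cinner (Z x) y = cinner x z"
  shows "cadjoint_on K K' Z y = z"
proof -
  have "(THE z. z \<in> K \<and> (\<forall>x\<in>K. cinner (Z x) y = cinner x z)) = z"
  proof (rule the_equality)
    fix w assume w: "w \<in> K \<and> (\<forall>x\<in>K. cinner (Z x) y = cinner x w)"
    have "w - z \<in> K"
      using w assms complex_vector.subspace_diff by blast
    moreover from this have "cinner (w - z) (w - z) = 0"
      using w eq by (subst cinner_diff_right) (metis diff_self)
    ultimately show "w = z"
      by (simp add: cinner_self)
  qed (use assms in blast)
  then show ?thesis
    using \<open>y \<in> K'\<close> by (simp add: cadjoint_on_def)
qed

lemma
  assumes Z: "contraction_between K K' Z" and K: "closed K" and y: "y \<in> K'"
  shows cadjoint_on_mem: "cadjoint_on K K' Z y \<in> K"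
    and cadjoint_on_cinner: "x \<in> K \<Longrightarrow> cinner (Z x) y = cinner x (cadjoint_on K K' Z y)"
proof -
  note ZD = contraction_betweenD[OF Z]
  have "\<exists>z\<in>K. \<forall>x\<in>K. inner (Z x) y = inner x z"
  proof (rule riesz_representation[OF csubspace_imp_subspace[OF ZD(1)] K, where C = "norm y"])
    show "\<bar>inner (Z x) y\<bar> \<le> norm y * norm x" if "x \<in> K" for x
      using Cauchy_Schwarz_ineq2[of "Z x" y] mult_right_mono[OF ZD(4)[OF that] norm_ge_zero[of y]]
      by (simp add: mult.commute)
    show "inner (Z (r *\<^sub>R x)) y = r * inner (Z x) y" if "x \<in> K" for r x
      using ZD(2) that by (simp add: linear_operator_def scaleR_scaleC[of _ x])
        (simp flip: scaleR_scaleC)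
  qed (use ZD(2) in \<open>auto simp: linear_operator_def inner_add_left\<close>)
  then obtain z where z: "z \<in> K" "\<And>x. x \<in> K \<Longrightarrow> inner (Z x) y = inner x z"
    by blast
  have eq: "cinner (Z x) y = cinner x z" if "x \<in> K" for x
    using cinner_eq_if_inner_eq[OF ZD(1,2) z(2) that] .
  then have "cadjoint_on K K' Z y = z"
    using cadjoint_on_eqI[OF ZD(1) y z(1)] by blast
  with z(1) eq show "cadjoint_on K K' Z y \<in> K"
    "x \<in> K \<Longrightarrow> cinner (Z x) y = cinner x (cadjoint_on K K' Z y)" by auto
qed

lemma contraction_between_cadjoint:
  assumes Z: "contraction_between K K' Z" and K: "closed K" and K': "complex_vector.subspace K'"
  shows "contraction_between K' K (cadjoint_on K K' Z)"
proof -
  let ?A = "cadjoint_on K K' Z"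
  note ZD = contraction_betweenD[OF Z] and mem = cadjoint_on_mem[OF Z K]
    and adj = cadjoint_on_cinner[OF Z K]
  have "?A (f + g) = ?A f + ?A g" if "f \<in> K'" "g \<in> K'" for f g
    using that ZD(1) K' mem adj
    by (intro cadjoint_on_eqI) (auto simp: complex_vector.subspace_add cinner_add_right)
  moreover have "?A (c *\<^sub>C f) = c *\<^sub>C ?A f" if "f \<in> K'" for c f
    using that ZD(1) K' mem adj
    by (intro cadjoint_on_eqI) (auto simp: complex_vector.subspace_scale cinner_scaleC_right)
  moreover have "norm (?A y) \<le> norm y" if "y \<in> K'" for y
  proof -
    have "(norm (?A y))\<^sup>2 = cmod (cinner (Z (?A y)) y)"
      using adj[OF that mem[OF that]] by (simp add: cinner_self norm_power)
    also have "\<dots> \<le> norm (Z (?A y)) * norm y"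
      by (rule norm_cinner_le)
    also have "\<dots> \<le> norm (?A y) * norm y"
      using ZD(4)[OF mem[OF that]] by (rule mult_right_mono) simp
    finally show ?thesis
      by (cases "norm (?A y) = 0") (auto simp: power2_eq_square)
  qed
  ultimately show ?thesis
    using mem K' by (auto simp: contraction_between_def linear_operator_def)
qed

lemma cadjoint_on_cadjoint:
  assumes Z: "contraction_between K K' Z" and K: "closed K" and K': "complex_vector.subspace K'"
    and "x \<in> K"
  shows "cadjoint_on K' K (cadjoint_on K K' Z) x = Z x"
proof (rule cadjoint_on_eqI[OF K' \<open>x \<in> K\<close>])
  show "Z x \<in> K'"
    using contraction_betweenD(3)[OF Z \<open>x \<in> K\<close>] .
  show "cinner (cadjoint_on K K' Z y) x = cinner y (Z x)" if "y \<in> K'" for y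
    using cadjoint_on_cinner[OF Z K that \<open>x \<in> K\<close>] by (metis cinner_commute)
qed

section \<open>Square roots and defect operators\<close>

text \<open>A solution \<open>B\<close> of \<open>B = (X + B\<^sup>2) / 2\<close> satisfies \<open>(I - B)\<^sup>2 = I - X\<close>. Iterating from \<open>0\<close> yields one
  whose norm is at most \<open>1\<close>, so that \<open>I - B\<close> is the nonnegative root.\<close>

primrec root_iter :: "('a::real_vector \<Rightarrow> 'a) \<Rightarrow> nat \<Rightarrow> 'a \<Rightarrow> 'a" where
  "root_iter X 0 x = 0"
| "root_iter X (Suc n) x = (1/2) *\<^sub>R (X x + root_iter X n (root_iter X n x))"

text \<open>The same iteration for the number \<open>1\<close> in place of \<open>X\<close>; it majorises the operator iteration
  for every contraction \<open>X\<close>.\<close>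

primrec root_bound :: "nat \<Rightarrow> real" where
  "root_bound 0 = 0"
| "root_bound (Suc n) = (1 + (root_bound n)\<^sup>2) / 2"

lemma root_bound_nonneg: "0 \<le> root_bound n"
  by (induction n) auto

lemma root_bound_le_1: "root_bound n \<le> 1"
  by (induction n) (use root_bound_nonneg in \<open>auto simp: power_le_one\<close>)

lemma incseq_root_bound: "incseq root_bound"
proof (rule incseq_SucI)
  fix n
  have "0 \<le> (1 - root_bound n)\<^sup>2" by simp
  then show "root_bound n \<le> root_bound (Suc n)"
    by (simp add: power2_eq_square algebra_simps)
qed

text \<open>The square root of \<open>I - X\<close>.\<close>

definition defect_root :: "('a::real_normed_vector \<Rightarrow> 'a) \<Rightarrow> 'a \<Rightarrow> 'a" where
  "defect_root X x = x - lim (\<lambda>n. root_iter X n x)"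

text \<open>The case of interest is \<open>X = Z\<^sup>* Z\<close> with a contraction \<open>Z\<close>.\<close>

locale symmetric_contraction =
  fixes K :: "'a::chilbert_space set" and X
  assumes contr: "contraction_between K K X" and closed_K: "closed K"
    and symm: "\<And>x y. x \<in> K \<Longrightarrow> y \<in> K \<Longrightarrow> cinner (X x) y = cinner x (X y)"
begin

lemmas subspace_K = contraction_betweenD(1)[OF contr]
lemmas linear_X = contraction_betweenD(2)[OF contr]

lemma root_iter_mem: "x \<in> K \<Longrightarrow> root_iter X n x \<in> K"
  using csubspace_imp_subspace[OF subspace_K] contraction_betweenD(3)[OF contr]
  by (induction n arbitrary: x) (auto simp: subspace_0 subspace_add subspace_scale)

lemma linear_root_iter: "linear_operator K (root_iter X n)"
proof (induction n)
  case (Suc n)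
  note IH = linear_operatorD[OF Suc] and lin = linear_operatorD[OF linear_X]
  show ?case
    by (rule linear_operatorI)
      (simp_all add: subspace_K lin IH root_iter_mem scaleC_add_right scaleR_scaleC_commute
        scaleR_add_right)
qed (simp add: linear_operator_def subspace_K)

lemma norm_root_iter_le: "x \<in> K \<Longrightarrow> norm (root_iter X n x) \<le> root_bound n * norm x"
proof (induction n arbitrary: x)
  case (Suc n)
  have "norm (root_iter X n (root_iter X n x)) \<le> root_bound n * norm (root_iter X n x)"
    using Suc.IH root_iter_mem Suc.prems by blast
  also have "\<dots> \<le> root_bound n * (root_bound n * norm x)"
    using Suc.IH[OF Suc.prems] by (rule mult_left_mono) (rule root_bound_nonneg)
  finally have "norm (X x + root_iter X n (root_iter X n x)) \<le> norm x + (root_bound n)\<^sup>2 * norm x"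
    using contraction_betweenD(4)[OF contr Suc.prems]
    by (intro norm_triangle_le add_mono) (simp_all add: power2_eq_square mult.assoc)
  then have "(1/2) * norm (X x + root_iter X n (root_iter X n x))
      \<le> (1/2) * (norm x + (root_bound n)\<^sup>2 * norm x)"
    by simp
  then show ?case by (simp only: root_iter.simps root_bound.simps norm_scaleR) (simp add: algebra_simps)
qed auto

text \<open>With \<open>B n\<close> the iterates,
  \<open>B (n+1) - B n = (B n (B n - B (n-1)) + (B n - B (n-1)) B (n-1)) / 2\<close>, so the increments inherit
  the bound from those of the scalar sequence.\<close>

lemma norm_root_iter_diff_Suc:
  "x \<in> K \<Longrightarrow> norm (root_iter X (Suc n) x - root_iter X n x) 
     \<le> (root_bound (Suc n) - root_bound n) * norm x"
proof (induction n arbitrary: x)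
  case 0
  then show ?case using contraction_betweenD(4)[OF contr] by simp
next
  case (Suc n)
  let ?B = "root_iter X (Suc n)" and ?A = "root_iter X n"
  let ?b = "root_bound (Suc n)" and ?a = "root_bound n"
  note IH = Suc.IH and x = Suc.prems
  have mem: "?A x \<in> K" "?B x \<in> K" "?B x - ?A x \<in> K"
    using root_iter_mem[OF x] complex_vector.subspace_diff[OF subspace_K] by blast+
  have ab: "0 \<le> ?a" "0 \<le> ?b" "?a \<le> ?b"
    by (rule root_bound_nonneg incseq_SucD[OF incseq_root_bound])+
  have step: "root_iter X (Suc (Suc n)) x - ?B x = (1/2) *\<^sub>R (?B (?B x) - ?A (?A x))"
  proof -
    have "root_iter X (Suc (Suc n)) x - ?B x
        = (1/2) *\<^sub>R (X x + ?B (?B x)) - (1/2) *\<^sub>R (X x + ?A (?A x))"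
      by (intro arg_cong2[where f = minus] root_iter.simps(2))
    then show ?thesis
      by (simp only: add_diff_cancel_left flip: scaleR_diff_right)
  qed
  have split: "?B (?B x) - ?A (?A x) = ?B (?B x - ?A x) + (?B (?A x) - ?A (?A x))"
    by (simp add: linear_operator_diff[OF linear_root_iter mem(2,1)] del: root_iter.simps)
  have "norm (root_iter X (Suc (Suc n)) x - ?B x)
      \<le> (norm (?B (?B x - ?A x)) + norm (?B (?A x) - ?A (?A x))) / 2"
    using norm_triangle_ineq[of "?B (?B x - ?A x)" "?B (?A x) - ?A (?A x)"]
    unfolding step split by (simp del: root_iter.simps)
  also have "\<dots> \<le> (?b * ((?b - ?a) * norm x) + (?b - ?a) * (?a * norm x)) / 2"
  proof (intro divide_right_mono add_mono)
    have "norm (?B (?B x - ?A x)) \<le> ?b * norm (?B x - ?A x)"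
      by (rule norm_root_iter_le[OF mem(3)])
    also have "\<dots> \<le> ?b * ((?b - ?a) * norm x)"
      by (intro mult_left_mono IH x ab)
    finally show "norm (?B (?B x - ?A x)) \<le> ?b * ((?b - ?a) * norm x)" .
    have "norm (?B (?A x) - ?A (?A x)) \<le> (?b - ?a) * norm (?A x)"
      by (rule IH[OF mem(1)])
    also have "\<dots> \<le> (?b - ?a) * (?a * norm x)"
      by (intro mult_left_mono norm_root_iter_le x) (use ab in simp)
    finally show "norm (?B (?A x) - ?A (?A x)) \<le> (?b - ?a) * (?a * norm x)" .
  qed simp
  also have "\<dots> = ((1 + ?b\<^sup>2) / 2 - (1 + ?a\<^sup>2) / 2) * norm x"
  proof -
    have "(b * ((b - a) * c) + (b - a) * (a * c)) / 2 = ((1 + b\<^sup>2) / 2 - (1 + a\<^sup>2) / 2) * c"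
      for a b c :: real
      by (simp add: field_simps power2_eq_square)
    then show ?thesis .
  qed
  also have "\<dots> = (root_bound (Suc (Suc n)) - ?b) * norm x"
    by (intro arg_cong2[where f = times] arg_cong2[where f = minus] refl
        root_bound.simps(2)[symmetric])
  finally show ?case .
qed

lemma norm_root_iter_diff:
  assumes "x \<in> K" "n \<le> m"
  shows "norm (root_iter X m x - root_iter X n x) \<le> (root_bound m - root_bound n) * norm x"
  using \<open>n \<le> m\<close>
proof (induction m rule: dec_induct)
  case (step m)
  have "root_iter X (Suc m) x - root_iter X n x
      = (root_iter X (Suc m) x - root_iter X m x) + (root_iter X m x - root_iter X n x)"
    by simp
  also have "norm \<dots> \<le> (root_bound (Suc m) - root_bound m) * norm x
      + (root_bound m - root_bound n) * norm x"
    by (intro order_trans[OF norm_triangle_ineq add_mono] norm_root_iter_diff_Suc assms step.IH)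
  finally show ?case by (simp only: left_diff_distrib)
qed simp

text \<open>The increments of the iteration are dominated by those of the scalar sequence, which is
  increasing and bounded by \<open>1\<close>.\<close>

lemma root_iter_converges:
  assumes "x \<in> K"
  shows "(\<lambda>n. root_iter X n x) \<longlonglongrightarrow> x - defect_root X x"
proof -
  have bound: "Cauchy root_bound"
    using incseq_convergent[OF incseq_root_bound, of 1] root_bound_le_1 LIMSEQ_imp_Cauchy
    by blast
  have "Cauchy (\<lambda>n. root_iter X n x)"
  proof (rule metric_CauchyI)
    fix e :: real assume "0 < e"
    then have "0 < e / (norm x + 1)"
      by (simp add: add_nonneg_pos)
    then obtain k where k: "\<And>m n. m \<ge> k \<Longrightarrow> n \<ge> k \<Longrightarrow> dist (root_bound m) (root_bound n) < e / (norm x + 1)"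
      using metric_CauchyD[OF bound] by blast
    have *: "dist (root_iter X m x) (root_iter X n x) < e" if "m \<ge> n" "n \<ge> k" for m n
    proof -
      have "dist (root_iter X m x) (root_iter X n x) \<le> (root_bound m - root_bound n) * norm x"
        using norm_root_iter_diff[OF assms that(1)] by (simp add: dist_norm)
      also have "\<dots> \<le> (root_bound m - root_bound n) * (norm x + 1)"
        using incseqD[OF incseq_root_bound that(1)] by (intro mult_left_mono) auto
      also have "\<dots> < e"
      proof -
        have "root_bound m - root_bound n < e / (norm x + 1)"
          using k[of m n] that by (auto simp: dist_real_def)
        then show ?thesis
          by (subst (asm) pos_less_divide_eq) (simp_all add: add_nonneg_pos)
      qed
      finally show ?thesis .
    qed
    show "\<exists>k. \<forall>m\<ge>k. \<forall>n\<ge>k. dist (root_iter X m x) (root_iter X n x) < e"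
    proof (intro exI allI impI)
      fix m n assume "m \<ge> k" "n \<ge> k"
      then show "dist (root_iter X m x) (root_iter X n x) < e"
        using *[of m n] *[of n m] by (cases "n \<le> m") (auto simp: dist_commute)
    qed
  qed
  then show ?thesis
    unfolding defect_root_def by (simp add: Cauchy_convergent_iff convergent_LIMSEQ_iff)
qed

lemma defect_root_mem:
  assumes "x \<in> K"
  shows "defect_root X x \<in> K"
proof -
  have "x - defect_root X x \<in> K"
    using closed_sequentially[OF closed_K _ root_iter_converges[OF assms]] root_iter_mem[OF assms]
    by blast
  then have "x - (x - defect_root X x) \<in> K"
    using assms complex_vector.subspace_diff[OF subspace_K] by blast
  then show ?thesis by simp
qed

lemma linear_defect_root: "linear_operator K (defect_root X)"
proof (rule linear_operatorI[OF subspace_K])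
  note lin = linear_operatorD[OF linear_root_iter]
  show "defect_root X (x + y) = defect_root X x + defect_root X y" if xy: "x \<in> K" "y \<in> K" for x y
  proof -
    have "(\<lambda>n. root_iter X n (x + y)) \<longlonglongrightarrow> (x - defect_root X x) + (y - defect_root X y)"
      unfolding lin(2)[OF xy] by (intro tendsto_add root_iter_converges xy)
    then have "(x + y) - defect_root X (x + y) = (x - defect_root X x) + (y - defect_root X y)"
      using root_iter_converges[OF complex_vector.subspace_add[OF subspace_K xy]]
      by (rule LIMSEQ_unique[symmetric])
    then show ?thesis by (simp add: algebra_simps)
  qed
  show "defect_root X (c *\<^sub>C x) = c *\<^sub>C defect_root X x" if x: "x \<in> K" for c x
  proof -
    have "(\<lambda>n. root_iter X n (c *\<^sub>C x)) \<longlonglongrightarrow> c *\<^sub>C (x - defect_root X x)"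
      unfolding lin(3)[OF x] by (intro tendsto_intros root_iter_converges x)
    then have "c *\<^sub>C x - defect_root X (c *\<^sub>C x) = c *\<^sub>C (x - defect_root X x)"
      using root_iter_converges[OF complex_vector.subspace_scale[OF subspace_K x]]
      by (rule LIMSEQ_unique[symmetric])
    then show ?thesis by (simp add: complex_vector.scale_right_diff_distrib)
  qed
qed

lemma norm_id_minus_defect_root_le:
  assumes "x \<in> K"
  shows "norm (x - defect_root X x) \<le> norm x"
proof (rule Lim_bounded[OF tendsto_norm[OF root_iter_converges[OF assms]], of 0], intro allI impI)
  show "norm (root_iter X n x) \<le> norm x" for n
    using norm_root_iter_le[OF assms, of n] mult_right_mono[OF root_bound_le_1 norm_ge_zero, of n x]
    by simp
qed

lemma symmetric_defect_root:
  assumes "x \<in> K" "y \<in> K"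
  shows "cinner (defect_root X x) y = cinner x (defect_root X y)"
proof -
  have iter: "cinner (root_iter X n x) y = cinner x (root_iter X n y)"
    if "x \<in> K" "y \<in> K" for n x y
    using that
    by (induction n arbitrary: x y)
      (simp_all add: cinner_add_left cinner_add_right symm root_iter_mem
        cinner_scaleC_left cinner_scaleC_right scaleR_scaleC)
  have "(\<lambda>n. cinner (root_iter X n x) y) \<longlonglongrightarrow> cinner (x - defect_root X x) y"
    by (intro tendsto_intros root_iter_converges assms)
  moreover have "(\<lambda>n. cinner (root_iter X n x) y) \<longlonglongrightarrow> cinner x (y - defect_root X y)"
    unfolding iter[OF assms] by (intro tendsto_intros root_iter_converges assms)
  ultimately have "cinner (x - defect_root X x) y = cinner x (y - defect_root X y)"
    by (rule LIMSEQ_unique)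
  then show ?thesis
    by (simp add: cinner_diff_left cinner_diff_right)
qed

lemma defect_root_nonneg:
  assumes "x \<in> K"
  shows "0 \<le> Re (cinner (defect_root X x) x)"
proof -
  have "inner (x - defect_root X x) x \<le> norm (x - defect_root X x) * norm x"
    by (rule norm_cauchy_schwarz)
  also have "\<dots> \<le> norm x * norm x"
    using norm_id_minus_defect_root_le[OF assms] by (rule mult_right_mono) simp
  finally show ?thesis
    by (simp add: inner_diff_left power2_norm_eq_inner[symmetric] power2_eq_square
        flip: inner_eq_Re_cinner)
qed

text \<open>The limit \<open>B\<close> of the iteration satisfies \<open>2 B = X + B\<^sup>2\<close>. Passing to the limit in the composed
  iterates is possible because all of them are contractions.\<close>

lemma defect_root_square:
  assumes x: "x \<in> K"
  shows "defect_root X (defect_root X x) = x - X x"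
proof -
  let ?S = "defect_root X"
  define B where "B = x - ?S x"
  have B: "B \<in> K"
    unfolding B_def by (intro complex_vector.subspace_diff[OF subspace_K] defect_root_mem x)
  have conv: "(\<lambda>n. root_iter X n x) \<longlonglongrightarrow> B"
    using root_iter_converges[OF x] by (simp add: B_def)
  \<comment> \<open>The iterates vary with \<open>n\<close> both outside and inside; \<open>root_iter X n\<close> is a contraction.\<close>
  have small: "(\<lambda>n. root_iter X n (root_iter X n x - B)) \<longlonglongrightarrow> 0"
  proof (rule Lim_null_comparison[OF always_eventually])
    show "\<forall>n. norm (root_iter X n (root_iter X n x - B)) \<le> norm (root_iter X n x - B)"
    proof
      fix n
      have "root_iter X n x - B \<in> K"
        using complex_vector.subspace_diff[OF subspace_K root_iter_mem[OF x] B] .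
      from norm_root_iter_le[OF this, of n]
      show "norm (root_iter X n (root_iter X n x - B)) \<le> norm (root_iter X n x - B)"
        using mult_right_mono[OF root_bound_le_1 norm_ge_zero, of n "root_iter X n x - B"] by simp
    qed
    show "(\<lambda>n. norm (root_iter X n x - B)) \<longlonglongrightarrow> 0"
      using conv by (intro tendsto_norm_zero) (simp add: LIM_zero)
  qed
  have "(\<lambda>n. root_iter X n (root_iter X n x - B) + root_iter X n B) \<longlonglongrightarrow> 0 + (B - ?S B)"
    by (intro tendsto_add small root_iter_converges B)
  then have "(\<lambda>n. root_iter X n (root_iter X n x)) \<longlonglongrightarrow> B - ?S B"
    by (simp add: linear_operator_diff[OF linear_root_iter root_iter_mem[OF x] B])
  then have "(\<lambda>n. (1/2) *\<^sub>R (X x + root_iter X n (root_iter X n x)))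
      \<longlonglongrightarrow> (1/2) *\<^sub>R (X x + (B - ?S B))"
    by (intro tendsto_intros)
  then have "(\<lambda>n. root_iter X (Suc n) x) \<longlonglongrightarrow> (1/2) *\<^sub>R (X x + (B - ?S B))"
    by simp
  then have "B = (1/2) *\<^sub>R (X x + (B - ?S B))"
    using LIMSEQ_Suc[OF conv] LIMSEQ_unique by blast
  then have "2 *\<^sub>R B = 2 *\<^sub>R (1/2) *\<^sub>R (X x + (B - ?S B))"
    by (rule arg_cong)
  then have "?S B = X x - B"
    by (simp add: scaleR_2 algebra_simps)
  moreover have "?S (?S x) = ?S x - ?S B"
    using linear_operator_diff[OF linear_defect_root x defect_root_mem[OF x]] by (simp add: B_def)
  ultimately have "?S (?S x) = ?S x - (X x - B)"
    by simp
  then show ?thesis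
    by (simp add: B_def)
qed

lemma nonneg_operator_defect_root: "nonneg_operator K (restrict (defect_root X) K)"
proof -
  have "norm (defect_root X x) \<le> 2 * norm x" if "x \<in> K" for x
    using norm_triangle_ineq4[of x "x - defect_root X x"] norm_id_minus_defect_root_le[OF that]
    by simp
  then show ?thesis
    using linear_operatorD[OF linear_defect_root]
    by (auto simp: nonneg_operator_def defect_root_mem defect_root_nonneg
        complex_vector.subspace_add complex_vector.subspace_scale
        intro!: linear_operatorI symmetric_defect_root)
qed

end

text \<open>Every iterate is a polynomial in \<open>X\<close>, so what intertwines \<open>X\<close> and \<open>X'\<close> intertwines
  the roots.\<close>

lemma defect_root_intertwine:
  assumes "symmetric_contraction K X" "symmetric_contraction K' X'"
    and C: "linear_operator K C" "\<And>x. x \<in> K \<Longrightarrow> C x \<in> K'" "\<And>x. x \<in> K \<Longrightarrow> norm (C x) \<le> c * norm x"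
    and CX: "\<And>x. x \<in> K \<Longrightarrow> C (X x) = X' (C x)"
    and x: "x \<in> K"
  shows "C (defect_root X x) = defect_root X' (C x)"
proof -
  interpret A: symmetric_contraction K X by fact
  interpret A': symmetric_contraction K' X' by fact
  note lin = linear_operatorD[OF C(1)]
  have XK: "\<And>x. x \<in> K \<Longrightarrow> X x \<in> K"
    using contraction_betweenD(3)[OF A.contr] .
  have iter: "C (root_iter X n x) = root_iter X' n (C x)" if "x \<in> K" for n x
    using that
    by (induction n arbitrary: x)
      (simp_all add: linear_operator_zero[OF C(1)] lin CX XK A.root_iter_mem
        complex_vector.subspace_add[OF A.subspace_K])
  define B where "B = x - defect_root X x"
  have B: "B \<in> K"
    unfolding B_def by (intro complex_vector.subspace_diff[OF A.subspace_K] A.defect_root_mem x)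
  have conv: "(\<lambda>n. root_iter X n x) \<longlonglongrightarrow> B"
    using A.root_iter_converges[OF x] by (simp add: B_def)
  have "(\<lambda>n. C (root_iter X n x - B)) \<longlonglongrightarrow> 0"
  proof (rule Lim_null_comparison[OF always_eventually])
    show "\<forall>n. norm (C (root_iter X n x - B)) \<le> c * norm (root_iter X n x - B)"
      using C(3) complex_vector.subspace_diff[OF A.subspace_K A.root_iter_mem[OF x] B] by blast
    show "(\<lambda>n. c * norm (root_iter X n x - B)) \<longlonglongrightarrow> 0"
      using conv by (intro tendsto_mult_right_zero tendsto_norm_zero) (simp add: LIM_zero)
  qed
  then have "(\<lambda>n. C (root_iter X n x)) \<longlonglongrightarrow> C B"
    by (subst (asm) linear_operator_diff[OF C(1) A.root_iter_mem[OF x] B]) (rule LIM_zero_cancel)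
  then have "C B = C x - defect_root X' (C x)"
    unfolding iter[OF x] using A'.root_iter_converges[OF C(2)[OF x]] LIMSEQ_unique by blast
  moreover have "C B = C x - C (defect_root X x)"
    unfolding B_def by (rule linear_operator_diff[OF C(1) x A.defect_root_mem[OF x]])
  ultimately show ?thesis by simp
qed

text \<open>The Cauchy--Schwarz inequality for the form \<open>(S x, y)\<close> gives \<open>(S y, z) = 0\<close> for every \<open>z\<close>.\<close>

lemma nonneg_operator_eq_zero:
  assumes S: "nonneg_operator K S" and y: "y \<in> K" and zero: "Re (cinner (S y) y) = 0"
  shows "S y = 0"
proof -
  have lin: "linear_operator K S" and SK: "\<And>x. x \<in> K \<Longrightarrow> S x \<in> K"
    and symm: "\<And>x y. x \<in> K \<Longrightarrow> y \<in> K \<Longrightarrow> cinner (S x) y = cinner x (S y)"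
    and nonneg: "\<And>x. x \<in> K \<Longrightarrow> 0 \<le> Re (cinner (S x) x)"
    using S by (auto simp: nonneg_operator_def)
  note linD = linear_operatorD[OF lin]
  define z where "z = S y"
  have z: "z \<in> K" by (simp add: z_def SK y)
  have "(inner (S y) z)\<^sup>2 \<le> 0 * inner (S z) z"
  proof (rule quadratic_nonneg_discriminant)
    fix t :: real
    have tz: "t *\<^sub>R z \<in> K" "y + t *\<^sub>R z \<in> K"
      using z y csubspace_imp_subspace[OF linD(1)] by (simp_all add: subspace_add subspace_scale)
    have "inner (S z) y = inner (S y) z"
      using arg_cong[OF symm[OF z y], of Re] by (simp add: inner_commute flip: inner_eq_Re_cinner)
    then show "0 \<le> 0 + 2 * t * inner (S y) z + t\<^sup>2 * inner (S z) z"
      using nonneg[OF tz(2)] zero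
      by (simp add: linD(2)[OF y tz(1)] linD(4)[OF z] inner_add power2_eq_square algebra_simps
          flip: inner_eq_Re_cinner)
  qed (use nonneg[OF z] in \<open>simp add: inner_eq_Re_cinner\<close>)
  then show ?thesis by (simp add: z_def)
qed

text \<open>If \<open>S\<close> is another nonnegative root, it commutes with \<open>X = I - S\<^sup>2\<close> and hence with the
  constructed root \<open>R\<close>. On \<open>y = (R - S) x\<close> the sum \<open>R + S\<close> vanishes, so both of its nonnegative
  summands do, and \<open>\<parallel>y\<parallel>\<^sup>2 = ((R - S) y, x) = 0\<close>.\<close>

lemma nonneg_sqrt_eq_defect_root:
  assumes sc: "symmetric_contraction K X"
  shows "nonneg_sqrt K (\<lambda>x. x - X x) = restrict (defect_root X) K"
proof -
  interpret symmetric_contraction K X by fact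
  let ?R = "restrict (defect_root X) K"
  note lin = linear_operatorD[OF linear_defect_root]
  show ?thesis
    unfolding nonneg_sqrt_def
  proof (rule the_equality)
    show "?R \<in> extensional K \<and> nonneg_operator K ?R \<and> (\<forall>x\<in>K. ?R (?R x) = x - X x)"
      by (simp add: nonneg_operator_defect_root defect_root_mem defect_root_square)
    fix S assume *: "S \<in> extensional K \<and> nonneg_operator K S \<and> (\<forall>x\<in>K. S (S x) = x - X x)"
    then obtain c where c: "\<forall>x\<in>K. norm (S x) \<le> c * norm x"
      unfolding nonneg_operator_def by blast
    have S: "linear_operator K S" "\<And>x. x \<in> K \<Longrightarrow> S x \<in> K"
        "\<And>x. x \<in> K \<Longrightarrow> norm (S x) \<le> c * norm x"
        and symmS: "\<And>x y. x \<in> K \<Longrightarrow> y \<in> K \<Longrightarrow> cinner (S x) y = cinner x (S y)"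
        and nonneg: "\<And>x. x \<in> K \<Longrightarrow> 0 \<le> Re (cinner (S x) x)"
        and square: "\<And>x. x \<in> K \<Longrightarrow> S (S x) = x - X x"
      using * c unfolding nonneg_operator_def by blast+
    have XK: "\<And>x. x \<in> K \<Longrightarrow> X x \<in> K"
      using contraction_betweenD(3)[OF contr] .
    have "S (X x) = X (S x)" if "x \<in> K" for x
    proof -
      have "S (X x) = S (x - S (S x))"
        by (simp add: square[OF that])
      also have "\<dots> = S x - S (S (S x))"
        by (intro linear_operator_diff[OF S(1)] S(2) that)
      also have "\<dots> = X (S x)"
        by (simp only: square[OF S(2)[OF that]]) simp
      finally show ?thesis .
    qed
    from defect_root_intertwine[OF sc sc S this]
    have comm: "S (defect_root X x) = defect_root X (S x)" if "x \<in> K" for x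
      using that by blast
    have "S x = ?R x" if x: "x \<in> K" for x
    proof -
      define y where "y = defect_root X x - S x"
      have y: "y \<in> K"
        unfolding y_def
        by (intro complex_vector.subspace_diff[OF subspace_K] S(2) defect_root_mem x)
      have "S y = S (defect_root X x) - S (S x)"
        unfolding y_def by (intro linear_operator_diff[OF S(1)] S(2) defect_root_mem x)
      moreover have "defect_root X y = defect_root X (defect_root X x) - defect_root X (S x)"
        unfolding y_def
        by (intro linear_operator_diff[OF linear_defect_root] S(2) defect_root_mem x)
      ultimately have sum: "S y + defect_root X y = 0"
        by (simp add: comm x square defect_root_square)
      have "Re (cinner (S y) y) + Re (cinner (defect_root X y) y) = 0"
        using arg_cong[OF sum, of "\<lambda>v. Re (cinner v y)"] by (simp add: cinner_add_left)
      then have "Re (cinner (S y) y) = 0"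
        using nonneg[OF y] defect_root_nonneg[OF y] by linarith
      then have "S y = 0"
        using nonneg_operator_eq_zero[of K S y] * y by blast
      with sum have Ry: "defect_root X y = 0" by simp
      have "cinner y y = cinner (defect_root X x) y - cinner (S x) y"
        by (subst y_def) (rule cinner_diff_left)
      also have "\<dots> = 0"
        by (simp add: symmetric_defect_root symmS x y \<open>S y = 0\<close> Ry)
      finally show ?thesis
        using x by (simp add: cinner_self y_def)
    qed
    then show "S = ?R"
      using * by (intro extensionalityI[of _ K]) auto
  qed
qed

locale contraction_pair =
  fixes K K' :: "'a::chilbert_space set" and Z :: "'a \<Rightarrow> 'a"
  assumes contr: "contraction_between K K' Z" and closed: "closed K" "closed K'"
    and subspace: "complex_vector.subspace K" "complex_vector.subspace K'"
begin

abbreviation "Zs \<equiv> cadjoint_on K K' Z"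
abbreviation "DZ \<equiv> defect_operator K K' Z"

lemmas Z_mem = contraction_betweenD(3)[OF contr]
lemmas norm_Z_le = contraction_betweenD(4)[OF contr]
lemmas linear_Z = contraction_betweenD(2)[OF contr]
lemmas adjoint_contr = contraction_between_cadjoint[OF contr closed(1) subspace(2)]
lemmas Zs_mem = contraction_betweenD(3)[OF adjoint_contr]
lemmas linear_Zs = contraction_betweenD(2)[OF adjoint_contr]
lemmas adjoint = cadjoint_on_cinner[OF contr closed(1)]

lemma adjoint_pair: "contraction_pair K' K Zs"
  by unfold_locales (simp_all add: adjoint_contr closed subspace)

lemma symmetric_contraction_ZsZ: "symmetric_contraction K (\<lambda>x. Zs (Z x))"
proof
  show "contraction_between K K (\<lambda>x. Zs (Z x))"
    unfolding contraction_between_def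
  proof (intro conjI ballI image_subsetI)
    show "linear_operator K (\<lambda>x. Zs (Z x))"
      by (rule linear_operatorI) (simp_all add: Z_mem subspace linear_operatorD(2-3)[OF linear_Z]
          linear_operatorD(2-3)[OF linear_Zs])
    show "norm (Zs (Z x)) \<le> norm x" if "x \<in> K" for x
      using contraction_betweenD(4)[OF adjoint_contr Z_mem[OF that]] norm_Z_le[OF that] by simp
  qed (simp add: Z_mem Zs_mem)
  show "cinner (Zs (Z x)) y = cinner x (Zs (Z y))" if "x \<in> K" "y \<in> K" for x y
  proof -
    have "cinner (Z y) (Z x) = cinner y (Zs (Z x))" "cinner (Z x) (Z y) = cinner x (Zs (Z y))"
      using adjoint Z_mem that by blast+
    then show ?thesis
      by (metis cinner_commute)
  qed
qed (rule closed)

sublocale ZsZ: symmetric_contraction K "\<lambda>x. Zs (Z x)"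
  by (rule symmetric_contraction_ZsZ)

lemma defect_operator_eq: "x \<in> K \<Longrightarrow> DZ x = defect_root (\<lambda>x. Zs (Z x)) x"
  by (simp add: defect_operator_def nonneg_sqrt_eq_defect_root[OF symmetric_contraction_ZsZ])

lemma defect_mem: "x \<in> K \<Longrightarrow> DZ x \<in> K"
  by (simp add: defect_operator_eq ZsZ.defect_root_mem)

lemma linear_defect: "linear_operator K DZ"
  using linear_operatorD[OF ZsZ.linear_defect_root]
  by (auto intro!: linear_operatorI simp: defect_operator_eq complex_vector.subspace_add
      complex_vector.subspace_scale)

lemma symmetric_defect: "x \<in> K \<Longrightarrow> y \<in> K \<Longrightarrow> cinner (DZ x) y = cinner x (DZ y)"
  by (simp add: defect_operator_eq ZsZ.symmetric_defect_root)

lemma defect_square: "x \<in> K \<Longrightarrow> DZ (DZ x) = x - Zs (Z x)"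
  by (simp add: defect_operator_eq ZsZ.defect_root_mem ZsZ.defect_root_square)

lemma norm_defect: "x \<in> K \<Longrightarrow> (norm (DZ x))\<^sup>2 = (norm x)\<^sup>2 - (norm (Z x))\<^sup>2"
proof -
  assume x: "x \<in> K"
  have "complex_of_real ((norm (DZ x))\<^sup>2) = cinner x (DZ (DZ x))"
    by (simp only: cinner_self[symmetric] symmetric_defect[OF x defect_mem[OF x]])
  also have "\<dots> = cinner x x - cinner (Z x) (Z x)"
    by (simp add: defect_square x cinner_diff_right adjoint Z_mem)
  finally show ?thesis
    by (metis cinner_self of_real_diff of_real_eq_iff)
qed

text \<open>\<open>Z\<close> intertwines \<open>Z\<^sup>* Z\<close> with \<open>Z Z\<^sup>*\<close>, hence the square roots.\<close>

lemma defect_intertwine: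
  assumes "x \<in> K"
  shows "Z (DZ x) = defect_operator K' K Zs (Z x)"
proof -
  interpret A: contraction_pair K' K Zs by (rule adjoint_pair)
  have "Z (defect_root (\<lambda>x. Zs (Z x)) x) = defect_root (\<lambda>y. A.Zs (Zs y)) (Z x)"
  proof (rule defect_root_intertwine[OF symmetric_contraction_ZsZ A.symmetric_contraction_ZsZ])
    show "norm (Z x) \<le> 1 * norm x" if "x \<in> K" for x
      using norm_Z_le[OF that] by simp
    show "Z (Zs (Z x)) = A.Zs (Zs (Z x))" if "x \<in> K" for x
      using cadjoint_on_cadjoint[OF contr closed(1) subspace(2)] Zs_mem Z_mem that by simp
  qed (use assms linear_Z Z_mem in auto)
  then show ?thesis
    by (simp add: defect_operator_eq A.defect_operator_eq Z_mem assms)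
qed

text \<open>With \<open>D\<close> and \<open>D\<^sub>*\<close> the defect operators of \<open>Z\<close> and \<open>Z\<^sup>*\<close>, from \<open>a - Z\<^sup>* b = D v\<close> follows
  \<open>b - Z a = (I - Z Z\<^sup>*) b - Z D v = D\<^sub>* (D\<^sub>* b - Z v)\<close>.\<close>

lemma defect_range_transfer:
  assumes a: "a \<in> K" and b: "b \<in> K'" and ran: "a - Zs b \<in> DZ ` K"
  shows "b - Z a \<in> defect_operator K' K Zs ` K'"
proof -
  interpret A: contraction_pair K' K Zs by (rule adjoint_pair)
  obtain v where v: "v \<in> K" "a - Zs b = DZ v"
    using ran by blast
  have "A.DZ (A.DZ b - Z v) = A.DZ (A.DZ b) - A.DZ (Z v)"
    by (intro linear_operator_diff[OF A.linear_defect] A.defect_mem Z_mem b v)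
  also have "\<dots> = b - A.Zs (Zs b) - Z (DZ v)"
    by (simp add: A.defect_square b defect_intertwine v)
  also have "A.Zs (Zs b) = Z (Zs b)"
    by (rule cadjoint_on_cadjoint[OF contr closed(1) subspace(2) Zs_mem[OF b]])
  also have "Z (DZ v) = Z a - Z (Zs b)"
    unfolding v(2)[symmetric] by (rule linear_operator_diff[OF linear_Z a Zs_mem[OF b]])
  finally have "b - Z a = A.DZ (A.DZ b - Z v)" by simp
  moreover have "A.DZ b - Z v \<in> K'"
    using complex_vector.subspace_diff[OF subspace(2) A.defect_mem[OF b] Z_mem[OF v(1)]] .
  ultimately show ?thesis by blast
qed

end

section \<open>Maximal dissipative operators\<close>

lemma Im_nonneg_LIMSEQ:
  fixes z :: "nat \<Rightarrow> complex"
  assumes "z \<longlonglongrightarrow> w" "\<And>n. 0 \<le> Im (z n)"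
  shows "0 \<le> Im w"
  using LIMSEQ_le_const[OF tendsto_Im[OF assms(1)], of 0] assms(2) by blast

locale dense_maximal_dissipative =
  fixes D :: "'a::chilbert_space set" and T :: "'a \<Rightarrow> 'a"
  assumes maximal: "maximal_dissipative D T" and dense: "densely_defined D"
begin

abbreviation "S \<equiv> hermitian_domain D T"

lemma linear_T: "linear_operator D T"
  and Im_nonneg: "f \<in> D \<Longrightarrow> 0 \<le> Im (cinner (T f) f)"
  using maximal by (auto simp: maximal_dissipative_def dissipative_def)

lemmas T_simps = linear_operatorD(2-4)[OF linear_T]
lemmas T_diff = linear_operator_diff[OF linear_T]
lemmas subspace_D = linear_operatorD(1)[OF linear_T]
lemmas D_intros = complex_vector.subspace_add[OF subspace_D] complex_vector.subspace_diff[OF subspace_D]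
  complex_vector.subspace_scale[OF subspace_D] subspace_scale[OF csubspace_imp_subspace[OF subspace_D]]

text \<open>Otherwise \<open>d + c e \<mapsto> T d + c v\<close> would be a proper dissipative extension.\<close>

lemma mem_domain_if_extension_dissipative:
  assumes ext: "\<And>d c. d \<in> D \<Longrightarrow> 0 \<le> Im (cinner (T d + c *\<^sub>C v) (d + c *\<^sub>C e))"
  shows "e \<in> D"
proof (rule ccontr)
  assume e: "e \<notin> D"
  have unique: "c = c' \<and> d = d'" if "d \<in> D" "d' \<in> D" "d + c *\<^sub>C e = d' + c' *\<^sub>C e" for c c' d d'
  proof -
    have eq: "(c - c') *\<^sub>C e = d' - d"
      using that(3) by (simp add: complex_vector.scale_left_diff_distrib algebra_simps)
    have "c = c'"
    proof (rule ccontr)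
      assume "c \<noteq> c'"
      then have "e = inverse (c - c') *\<^sub>C (d' - d)"
        by (simp flip: eq add: scaleC_scaleC)
      with e that(1,2) show False
        by (metis D_intros(2,3))
    qed
    with that(3) show ?thesis by simp
  qed
  define D' where "D' = {d + c *\<^sub>C e | d c. d \<in> D}"
  define T' where "T' x = (THE y. \<exists>d\<in>D. \<exists>c. x = d + c *\<^sub>C e \<and> y = T d + c *\<^sub>C v)" for x
  have T': "T' (d + c *\<^sub>C e) = T d + c *\<^sub>C v" if "d \<in> D" for d c
    unfolding T'_def using unique that by (intro the_equality) blast+
  have DD': "D \<subseteq> D'"
    unfolding D'_def by (auto intro: exI[of _ 0] simp: complex_vector.scale_zero_left)
      (metis add.right_neutral complex_vector.scale_zero_left)
  have eD': "e \<in> D'"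
    unfolding D'_def using complex_vector.subspace_0[OF subspace_D]
    by (auto intro!: exI[of _ 0] exI[of _ 1])
  have sum: "(d + c *\<^sub>C e) + (d' + c' *\<^sub>C e) = (d + d') + (c + c') *\<^sub>C e" for d d' c c'
    by (simp add: scaleC_add_left algebra_simps)
  have scale: "r *\<^sub>C (d + c *\<^sub>C e) = r *\<^sub>C d + (r * c) *\<^sub>C e" for r d c
    by (simp add: scaleC_add_right scaleC_scaleC)
  have "complex_vector.subspace D'"
    unfolding complex_vector.subspace_def
  proof (intro conjI ballI allI)
    show "0 \<in> D'"
      using DD' complex_vector.subspace_0[OF subspace_D] by blast
    show "x + y \<in> D'" if "x \<in> D'" "y \<in> D'" for x y
      using that D_intros(1) sum unfolding D'_def by blast
    show "r *\<^sub>C x \<in> D'" if "x \<in> D'" for r x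
      using that D_intros(3) scale unfolding D'_def by blast
  qed
  moreover have "T' (x + y) = T' x + T' y" if "x \<in> D'" "y \<in> D'" for x y
  proof -
    obtain d c d' c' where "d \<in> D" "d' \<in> D" and xy: "x = d + c *\<^sub>C e" "y = d' + c' *\<^sub>C e"
      using \<open>x \<in> D'\<close> \<open>y \<in> D'\<close> unfolding D'_def by blast
    then show ?thesis
      unfolding xy sum by (simp only: T' D_intros T_simps) (simp add: scaleC_add_left)
  qed
  moreover have "T' (r *\<^sub>C x) = r *\<^sub>C T' x" if "x \<in> D'" for r x
  proof -
    obtain d c where "d \<in> D" and x: "x = d + c *\<^sub>C e"
      using \<open>x \<in> D'\<close> unfolding D'_def by blast
    then show ?thesis
      unfolding x scale by (simp add: T' D_intros T_simps scaleC_add_right scaleC_scaleC)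
  qed
  ultimately have "linear_operator D' T'"
    by (intro linear_operatorI)
  moreover have "0 \<le> Im (cinner (T' x) x)" if "x \<in> D'" for x
    using that ext T' unfolding D'_def by auto
  ultimately have "dissipative D' T'"
    by (simp add: dissipative_def)
  moreover have "T' d = T d" if "d \<in> D" for d
    using T'[OF that, of 0] by simp
  ultimately show False
    using maximal DD' e eD' unfolding maximal_dissipative_def by blast
qed

lemma eq_zero_if_orthogonal_domain:
  assumes "\<And>f. f \<in> D \<Longrightarrow> cinner f u = 0"
  shows "u = 0"
proof -
  have "u \<in> closure D"
    using dense by (simp add: densely_defined_def)
  then obtain s where s: "\<And>n. s n \<in> D" "s \<longlonglongrightarrow> u"
    unfolding closure_sequential by blast
  have "(\<lambda>n. cinner (s n) u) \<longlonglongrightarrow> cinner u u"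
    by (intro tendsto_intros s)
  then have "cinner u u = 0"
    using assms s(1) LIMSEQ_unique[OF _ tendsto_const] by simp
  then show ?thesis
    by (simp add: cinner_self)
qed

text \<open>By maximality the limit \<open>f\<close> is in the domain. Where \<open>T\<close> fails to be closed, there are
  \<open>w n \<rightarrow> 0\<close> with \<open>T (w n) \<rightarrow> k\<close>, and dissipativity at \<open>d + c w n\<close> gives \<open>Im (T d + c k, d) \<ge> 0\<close> for
  every \<open>c\<close>, so that \<open>k\<close> is orthogonal to the dense domain.\<close>

lemma closed_graph:
  assumes s: "\<And>n. s n \<in> D" "s \<longlonglongrightarrow> f" and Ts: "(\<lambda>n. T (s n)) \<longlonglongrightarrow> g"
  shows "f \<in> D" "T f = g"
proof -
  have nonneg: "0 \<le> Im (cinner (T d + c *\<^sub>C T w) (d + c *\<^sub>C w))" if "d \<in> D" "w \<in> D" for c d w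
    using Im_nonneg[of "d + c *\<^sub>C w"] that by (simp add: D_intros T_simps)
  show f: "f \<in> D"
  proof (rule mem_domain_if_extension_dissipative)
    fix d c assume d: "d \<in> D"
    have "(\<lambda>n. cinner (T d + c *\<^sub>C T (s n)) (d + c *\<^sub>C s n)) \<longlonglongrightarrow> cinner (T d + c *\<^sub>C g) (d + c *\<^sub>C f)"
      by (intro tendsto_intros s Ts)
    then show "0 \<le> Im (cinner (T d + c *\<^sub>C g) (d + c *\<^sub>C f))"
      using nonneg[OF d s(1)] by (rule Im_nonneg_LIMSEQ)
  qed
  have "cinner d (g - T f) = 0" if d: "d \<in> D" for d
  proof (rule ccontr)
    define z where "z = cinner (g - T f) d"
    assume "cinner d (g - T f) \<noteq> 0"
    then have z: "z \<noteq> 0"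
      unfolding z_def by (metis cinner_commute complex_cnj_zero)
    have *: "0 \<le> Im (cinner (T d) d) + Im (c * z)" for c
    proof -
      have "(\<lambda>n. cinner (T d + c *\<^sub>C (T (s n) - T f)) (d + c *\<^sub>C (s n - f)))
          \<longlonglongrightarrow> cinner (T d + c *\<^sub>C (g - T f)) (d + c *\<^sub>C (f - f))"
        by (intro tendsto_intros s Ts)
      moreover have "0 \<le> Im (cinner (T d + c *\<^sub>C (T (s n) - T f)) (d + c *\<^sub>C (s n - f)))" for n
        using nonneg[OF d, of "s n - f" c] s(1) f by (simp add: D_intros T_diff)
      ultimately show ?thesis
        using Im_nonneg_LIMSEQ
        by (fastforce simp: z_def cinner_add_left cinner_scaleC_left)
    qed
    \<comment> \<open>A factor \<open>c\<close> for which \<open>c z = - \<i> (Im (T d, d) + 1)\<close>.\<close>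
    define r where "r = (Im (cinner (T d) d) + 1) / (cmod z)\<^sup>2"
    have "Im ((- \<i> * complex_of_real r * cnj z) * z) = - (r * (cmod z)\<^sup>2)"
      unfolding cmod_power2 by (simp add: power2_eq_square algebra_simps)
    with *[of "- \<i> * complex_of_real r * cnj z"] show False
      using z by (simp add: r_def)
  qed
  then have "g - T f = 0"
    by (rule eq_zero_if_orthogonal_domain)
  then show "T f = g" by simp
qed

lemma linear_shifted: "linear_operator D (\<lambda>f. T f - c *\<^sub>C f)"
  by (rule linear_operatorI)
    (simp_all add: subspace_D T_simps scaleC_add_right complex_vector.scale_right_diff_distrib
      scaleC_scaleC mult.commute)

lemma cayley_lower_bound:
  assumes "Im \<mu> > 0" "f \<in> D"
  shows "Im \<mu> * norm f \<le> norm (T f - cnj \<mu> *\<^sub>C f)"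
proof -
  have "Im (cinner (T f - cnj \<mu> *\<^sub>C f) f) = Im (cinner (T f) f) + Im \<mu> * (norm f)\<^sup>2"
    by (simp add: cinner_diff_left cinner_scaleC_left cinner_self)
  then have "Im \<mu> * (norm f)\<^sup>2 \<le> Im (cinner (T f - cnj \<mu> *\<^sub>C f) f)"
    using Im_nonneg[OF assms(2)] by simp
  also have "\<dots> \<le> cmod (cinner (T f - cnj \<mu> *\<^sub>C f) f)"
    using abs_Im_le_cmod by (rule order_trans[OF abs_ge_self])
  also have "\<dots> \<le> norm (T f - cnj \<mu> *\<^sub>C f) * norm f"
    by (rule norm_cinner_le)
  finally have "(Im \<mu> * norm f) * norm f \<le> norm (T f - cnj \<mu> *\<^sub>C f) * norm f"
    by (simp add: power2_eq_square mult.assoc)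
  then show ?thesis
    by (cases "f = 0") (auto simp: mult_le_cancel_right)
qed

text \<open>The range is closed by the lower bound and the closed graph. A vector \<open>h\<close> orthogonal to it
  admits the dissipative extension \<open>h \<mapsto> \<mu> h\<close>, hence lies in the domain, and then
  \<open>Im ((T - cnj \<mu>) h, h) = 0\<close> forces \<open>h = 0\<close>.\<close>

lemma range_shifted:
  assumes mu: "Im \<mu> > 0"
  shows "\<exists>f\<in>D. y = T f - cnj \<mu> *\<^sub>C f"
proof -
  define A where "A f = T f - cnj \<mu> *\<^sub>C f" for f
  have A_diff: "A (f - g) = A f - A g" if "f \<in> D" "g \<in> D" for f g
    unfolding A_def by (rule linear_operator_diff[OF linear_shifted that])
  have sub: "complex_vector.subspace (A ` D)"
    unfolding A_def by (rule csubspace_image[OF linear_shifted subspace_D order_refl])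
  have "closed (A ` D)"
    unfolding closed_sequential_limits
  proof (intro allI impI)
    fix x l assume x: "(\<forall>n. x n \<in> A ` D) \<and> x \<longlonglongrightarrow> l"
    then have "\<forall>n. \<exists>f\<in>D. x n = A f" by blast
    then obtain s where s: "\<And>n. s n \<in> D" "\<And>n. x n = A (s n)" by metis
    have dist: "Im \<mu> * dist (s m) (s n) \<le> dist (x m) (x n)" for m n
      using cayley_lower_bound[OF mu, of "s m - s n"] A_diff[OF s(1) s(1), of m n] s
      by (simp add: dist_norm A_def D_intros)
    have "Cauchy s"
    proof (rule metric_CauchyI)
      fix e :: real assume "0 < e"
      then obtain n0 where n0: "\<And>m n. m \<ge> n0 \<Longrightarrow> n \<ge> n0 \<Longrightarrow> dist (x m) (x n) < Im \<mu> * e"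
        using metric_CauchyD[OF LIMSEQ_imp_Cauchy] x mu mult_pos_pos by metis
      have "dist (s m) (s n) < e" if "m \<ge> n0" "n \<ge> n0" for m n
        using order.strict_trans1[OF dist n0[OF that]] mu by simp
      then show "\<exists>n0. \<forall>m\<ge>n0. \<forall>n\<ge>n0. dist (s m) (s n) < e" by blast
    qed
    then obtain f where f: "s \<longlonglongrightarrow> f"
      using Cauchy_convergent convergent_def by blast
    have "(\<lambda>n. x n + cnj \<mu> *\<^sub>C s n) \<longlonglongrightarrow> l + cnj \<mu> *\<^sub>C f"
      using x by (intro tendsto_intros f) auto
    then have "(\<lambda>n. T (s n)) \<longlonglongrightarrow> l + cnj \<mu> *\<^sub>C f"
      by (simp add: s(2) A_def)
    from closed_graph[OF s(1) f this] have "f \<in> D" "A f = l"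
      by (simp_all add: A_def)
    then show "l \<in> A ` D" by blast
  qed
  note proj = cproj_mem[OF sub this] cproj_orthogonal[OF sub this]
  define h where "h = y - cproj (A ` D) y"
  have orth: "cinner (A f) h = 0" if "f \<in> D" for f
    using proj(2)[of y] that unfolding corthogonal_def h_def
    by (metis (mono_tags, lifting) cinner_commute complex_cnj_zero imageI mem_Collect_eq)
  have "h \<in> D"
  proof (rule mem_domain_if_extension_dissipative)
    fix d c assume d: "d \<in> D"
    have Td: "cinner (T d) h = cnj \<mu> * cinner d h"
      using orth[OF d] by (simp add: A_def cinner_diff_left cinner_scaleC_left)
    \<comment> \<open>The mixed terms are conjugate to each other and cancel in the imaginary part.\<close>
    define w where "w = c * \<mu> * cinner h d"
    have hd: "cinner d h = cnj (cinner h d)"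
      by (rule cinner_commute)
    have "cinner (T d + c *\<^sub>C \<mu> *\<^sub>C h) (d + c *\<^sub>C h)
        = cinner (T d) d + (cnj w + w) + (c * cnj c) * \<mu> * cinner h h"
      by (simp add: cinner_add_left cinner_add_right cinner_scaleC_left cinner_scaleC_right
          Td hd w_def algebra_simps)
    also have "\<dots> = cinner (T d) d + (cnj w + w) + complex_of_real ((cmod c)\<^sup>2 * (norm h)\<^sup>2) * \<mu>"
      unfolding complex_norm_square[symmetric] by (simp add: cinner_self)
    finally have "Im (cinner (T d + c *\<^sub>C \<mu> *\<^sub>C h) (d + c *\<^sub>C h))
        = Im (cinner (T d) d) + (cmod c)\<^sup>2 * (norm h)\<^sup>2 * Im \<mu>"
      by (simp del: of_real_mult of_real_power)
    then show "0 \<le> Im (cinner (T d + c *\<^sub>C \<mu> *\<^sub>C h) (d + c *\<^sub>C h))"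
      using Im_nonneg[OF d] mu by simp
  qed
  then have "Im (cinner (T h) h) + Im \<mu> * (norm h)\<^sup>2 = 0"
    using arg_cong[OF orth[of h], of Im]
    by (simp add: A_def cinner_diff_left cinner_scaleC_left cinner_self)
  then have "Im \<mu> * (norm h)\<^sup>2 \<le> 0"
    using Im_nonneg[OF \<open>h \<in> D\<close>] by linarith
  then have "h = 0"
    using mu by (simp add: mult_le_0_iff)
  then have "y \<in> A ` D"
    using proj(1)[of y] by (simp add: h_def)
  then show ?thesis
    by (auto simp: A_def)
qed

section \<open>The Hermitian domain\<close>

text \<open>\<open>Im (T f, f)\<close> is a nonnegative quadratic form on the domain, and \<open>(Im (T f, g) + Im (T g, f)) / 2\<close>
  is the real symmetric bilinear form that belongs to it.\<close>

lemma form_Cauchy_Schwarz: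
  assumes "f \<in> D" "g \<in> D"
  shows "(Im (cinner (T f) g) + Im (cinner (T g) f))\<^sup>2
    \<le> 4 * Im (cinner (T f) f) * Im (cinner (T g) g)"
proof -
  have "((Im (cinner (T f) g) + Im (cinner (T g) f)) / 2)\<^sup>2
      \<le> Im (cinner (T f) f) * Im (cinner (T g) g)"
  proof (rule quadratic_nonneg_discriminant)
    fix t :: real
    have tg: "t *\<^sub>R g \<in> D" using assms by (simp add: D_intros)
    have "0 \<le> Im (cinner (T (f + t *\<^sub>R g)) (f + t *\<^sub>R g))"
      using assms tg by (intro Im_nonneg D_intros)
    also have "T (f + t *\<^sub>R g) = T f + t *\<^sub>R T g"
      using assms tg by (simp add: T_simps)
    finally have "0 \<le> Im (cinner (T f) f)
        + t * (Im (cinner (T f) g) + Im (cinner (T g) f)) + t\<^sup>2 * Im (cinner (T g) g)"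
      by (simp add: scaleR_scaleC cinner_add_left cinner_add_right cinner_scaleC_left
          cinner_scaleC_right power2_eq_square algebra_simps)
    then show "0 \<le> Im (cinner (T f) f)
        + 2 * t * ((Im (cinner (T f) g) + Im (cinner (T g) f)) / 2) + t\<^sup>2 * Im (cinner (T g) g)"
      by simp
  qed (use Im_nonneg[OF assms(2)] in simp)
  then show ?thesis
    by (simp add: power_divide)
qed

lemma hermitian_mem: "s \<in> S \<Longrightarrow> s \<in> D"
  by (simp add: hermitian_domain_def)

text \<open>By the Cauchy--Schwarz inequality \<open>Im (T f, g) + Im (T g, f)\<close> vanishes as soon as
  \<open>f \<in> S\<close>; replacing \<open>g\<close> by \<open>\<i> g\<close> recovers the real part.\<close>

lemma hermitian_symmetric:
  assumes s: "s \<in> S" and g: "g \<in> D"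
  shows "cinner (T s) g = cinner s (T g)"
proof -
  have zero: "Im (cinner (T s) g) + Im (cinner (T g) s) = 0" if "g \<in> D" for g
    using form_Cauchy_Schwarz[OF hermitian_mem[OF s] that] s by (simp add: hermitian_domain_def)
  have "Re (cinner (T s) g) = Re (cinner (T g) s)"
    using zero[of "\<i> *\<^sub>C g"] g
    by (simp add: D_intros T_simps cinner_scaleC_left cinner_scaleC_right)
  moreover have "Im (cinner (T s) g) = - Im (cinner (T g) s)"
    using zero[OF g] by simp
  ultimately have "cinner (T s) g = cnj (cinner (T g) s)"
    by (simp add: complex_eq_iff)
  then show ?thesis
    by (metis cinner_commute)
qed

lemma hermitian_iff: "s \<in> S \<longleftrightarrow> s \<in> D \<and> (\<forall>g\<in>D. cinner (T s) g = cinner s (T g))"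
proof
  show "s \<in> S" if *: "s \<in> D \<and> (\<forall>g\<in>D. cinner (T s) g = cinner s (T g))"
  proof -
    have "cinner (T s) s = cnj (cinner (T s) s)"
      using * by (metis cinner_commute)
    then have "Im (cinner (T s) s) = 0"
      by (simp add: complex_eq_iff)
    with * show ?thesis by (simp add: hermitian_domain_def)
  qed
qed (simp add: hermitian_mem hermitian_symmetric)

lemma csubspace_hermitian: "complex_vector.subspace S"
  unfolding complex_vector.subspace_def hermitian_iff
  using complex_vector.subspace_0[OF subspace_D] linear_operator_zero[OF linear_T]
  by (auto simp: D_intros T_simps cinner_add_left cinner_scaleC_left hermitian_mem
      hermitian_symmetric)

lemma D_sing_iff:
  "D_sing D T \<longleftrightarrow> (\<forall>f\<in>D. \<exists>s. (\<forall>n. s n \<in> D) \<and> s \<longlonglongrightarrow> f \<and> (\<lambda>n. Im (cinner (T (s n)) (s n))) \<longlonglongrightarrow> 0)"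
  using maximal by (simp add: D_sing_def)

lemma D_sing_if_hermitian_dense:
  assumes "closure S = UNIV"
  shows "D_sing D T"
  unfolding D_sing_iff
proof
  fix f assume "f \<in> D"
  have "f \<in> closure S" using assms by simp
  then obtain s where "\<And>n. s n \<in> S" "s \<longlonglongrightarrow> f"
    unfolding closure_sequential by blast
  then show "\<exists>s. (\<forall>n. s n \<in> D) \<and> s \<longlonglongrightarrow> f \<and> (\<lambda>n. Im (cinner (T (s n)) (s n))) \<longlonglongrightarrow> 0"
    by (intro exI[of _ s]) (simp add: hermitian_domain_def)
qed

text \<open>Let \<open>s n \<rightarrow> f\<close> with \<open>Im (T (s n), s n) \<rightarrow> 0\<close>. The form \<open>Im (T f, s n) + Im (T (s n), f)\<close> tends to
  \<open>0\<close> by the Cauchy--Schwarz inequality; if \<open>f\<close> is in the domain of the adjoint, it also tends to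
  \<open>2 Im (T f, f)\<close>.\<close>

lemma hermitian_eq_if_D_sing:
  assumes "D_sing D T"
  shows "S = D \<inter> adjoint_domain D T"
proof (intro equalityI subsetI)
  fix f assume "f \<in> S"
  then have "\<forall>g\<in>D. cinner (T g) f = cinner g (T f)"
    using hermitian_symmetric by (metis cinner_commute)
  then show "f \<in> D \<inter> adjoint_domain D T"
    using hermitian_mem[OF \<open>f \<in> S\<close>] by (auto simp: adjoint_domain_def)
next
  fix f assume "f \<in> D \<inter> adjoint_domain D T"
  then obtain h where f: "f \<in> D" and h: "\<And>g. g \<in> D \<Longrightarrow> cinner (T g) f = cinner g h"
    by (auto simp: adjoint_domain_def)
  obtain s where s: "\<And>n. s n \<in> D" "s \<longlonglongrightarrow> f" "(\<lambda>n. Im (cinner (T (s n)) (s n))) \<longlonglongrightarrow> 0"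
    using assms f unfolding D_sing_iff by blast
  let ?p = "\<lambda>n. Im (cinner (T f) (s n)) + Im (cinner (T (s n)) f)"
  have "(\<lambda>n. (?p n)\<^sup>2) \<longlonglongrightarrow> 0"
  proof (rule Lim_null_comparison[OF always_eventually])
    show "\<forall>n. norm ((?p n)\<^sup>2) \<le> 4 * Im (cinner (T f) f) * Im (cinner (T (s n)) (s n))"
      using form_Cauchy_Schwarz[OF f s(1)] by simp
    show "(\<lambda>n. 4 * Im (cinner (T f) f) * Im (cinner (T (s n)) (s n))) \<longlonglongrightarrow> 0"
      by (intro tendsto_mult_right_zero s)
  qed
  moreover have "(\<lambda>n. (?p n)\<^sup>2) \<longlonglongrightarrow> (Im (cinner (T f) f) + Im (cinner f h))\<^sup>2"
    unfolding h[OF s(1)] by (intro tendsto_intros s)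
  ultimately have "(Im (cinner (T f) f) + Im (cinner f h))\<^sup>2 = 0"
    using LIMSEQ_unique by blast
  then show "f \<in> S"
    using f by (simp add: hermitian_domain_def flip: h[OF f])
qed

end

section \<open>The Cayley transform and the criterion for singularity\<close>

locale cayley_transform = dense_maximal_dissipative D T
  for D :: "'a::chilbert_space set" and T :: "'a \<Rightarrow> 'a" +
  fixes \<mu> :: complex
  assumes Im_mu: "Im \<mu> > 0"
begin

abbreviation A :: "'a \<Rightarrow> 'a" where "A f \<equiv> T f - cnj \<mu> *\<^sub>C f"
abbreviation "Y \<equiv> cayley D T \<mu>"
abbreviation "N \<equiv> deficiency_subspace D T \<mu>"
abbreviation "N' \<equiv> deficiency_subspace D T (cnj \<mu>)"
abbreviation "M \<equiv> M_op D T \<mu>"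
abbreviation "L \<equiv> corthogonal S"
abbreviation "R \<equiv> A ` S"

lemma A_surj: obtains f where "f \<in> D" "x = A f"
  using range_shifted[OF Im_mu] by blast

lemma inj_A: "inj_on A D"
proof (rule inj_onI)
  fix f g assume fg: "f \<in> D" "g \<in> D" "A f = A g"
  have "A (f - g) = 0"
    using linear_operator_diff[OF linear_shifted fg(1,2)] fg(3) by simp
  then have "Im \<mu> * norm (f - g) \<le> 0"
    using cayley_lower_bound[OF Im_mu D_intros(2)[OF fg(1,2)]] by simp
  then show "f = g"
    using Im_mu by (simp add: mult_le_0_iff)
qed

lemma cayley_A: "f \<in> D \<Longrightarrow> Y (A f) = T f - \<mu> *\<^sub>C f"
  by (simp add: cayley_def inv_into_f_f[OF inj_A] Let_def)

lemma linear_Y: "linear_operator UNIV Y"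
proof (rule linear_operatorI)
  note linA = linear_operatorD[OF linear_shifted[of "cnj \<mu>"]]
    and linB = linear_operatorD[OF linear_shifted[of \<mu>]]
  fix x y
  obtain f g where fg: "f \<in> D" "x = A f" "g \<in> D" "y = A g"
    using A_surj by metis
  then have "Y (x + y) = Y (A (f + g))"
    using linA(2) by metis
  also have "\<dots> = Y x + Y y"
    using fg cayley_A D_intros(1) linB(2) by metis
  finally show "Y (x + y) = Y x + Y y" .
next
  note linA = linear_operatorD[OF linear_shifted[of "cnj \<mu>"]]
    and linB = linear_operatorD[OF linear_shifted[of \<mu>]]
  fix c x
  obtain f where f: "f \<in> D" "x = A f"
    using A_surj by metis
  then have "Y (c *\<^sub>C x) = Y (A (c *\<^sub>C f))"
    using linA(3) by metis
  also have "\<dots> = c *\<^sub>C Y x"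
    using f cayley_A D_intros(3) linB(3) by metis
  finally show "Y (c *\<^sub>C x) = c *\<^sub>C Y x" .
qed (rule complex_vector.subspace_UNIV)

lemmas Y_simps = linear_operatorD(2-4)[OF linear_Y, OF UNIV_I]
lemmas Y_add = linear_operatorD(2)[OF linear_Y UNIV_I UNIV_I]

lemma id_minus_Y: "f \<in> D \<Longrightarrow> A f - Y (A f) = (\<mu> - cnj \<mu>) *\<^sub>C f"
  by (simp add: cayley_A complex_vector.scale_left_diff_distrib)

lemma mu_nonreal: "\<mu> - cnj \<mu> \<noteq> 0"
  using Im_mu by (auto simp: complex_eq_iff)

text \<open>The deviation of \<open>Y\<close> from an isometry is the dissipation of \<open>T\<close>.\<close>

lemma norm_Y:
  assumes "f \<in> D"
  shows "(norm (A f))\<^sup>2 - (norm (Y (A f)))\<^sup>2 = 4 * Im \<mu> * Im (cinner (T f) f)"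
proof -
  have norm: "(norm (T f - c *\<^sub>C f))\<^sup>2
      = (norm (T f))\<^sup>2 + (norm (c *\<^sub>C f))\<^sup>2 - 2 * Re (cnj c * cinner (T f) f)" for c
    by (simp add: power2_norm_eq_inner inner_diff inner_commute[of "c *\<^sub>C f" "T f"])
      (simp add: inner_eq_Re_cinner cinner_scaleC_right)
  show ?thesis
    unfolding cayley_A[OF assms] norm by (simp add: norm_scaleC algebra_simps)
qed

lemma norm_Y_le: "norm (Y x) \<le> norm x"
proof -
  obtain f where f: "f \<in> D" "x = A f" by (rule A_surj)
  have "0 \<le> 4 * Im \<mu> * Im (cinner (T f) f)"
    using Im_nonneg[OF f(1)] Im_mu by simp
  then have "(norm (Y x))\<^sup>2 \<le> (norm x)\<^sup>2"
    using norm_Y[OF f(1)] unfolding f(2) by linarith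
  then show ?thesis
    by (rule power2_le_imp_le) simp
qed

text \<open>On \<open>R = (T - cnj \<mu>) S\<close> the contraction \<open>Y\<close> is isometric, so \<open>Y\<^sup>* Y\<close> is the identity there.\<close>

lemma cinner_Y_hermitian:
  assumes s: "s \<in> S"
  shows "cinner (Y x) (Y (A s)) = cinner x (A s)"
proof -
  obtain f where f: "f \<in> D" "x = A f" by (rule A_surj)
  have "cinner (T f) s = cinner f (T s)"
    using hermitian_symmetric[OF s f(1)] by (metis cinner_commute)
  then show ?thesis
    unfolding f(2) cayley_A[OF f(1)] cayley_A[OF hermitian_mem[OF s]]
    by (simp add: cinner_expand algebra_simps)
qed

text \<open>Equality of norms means \<open>Im (T f, f) = 0\<close>. This description shows that \<open>R\<close> is closed.\<close>

lemma mem_R_iff: "x \<in> R \<longleftrightarrow> norm (Y x) = norm x"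
proof -
  obtain f where f: "f \<in> D" "x = A f" by (rule A_surj)
  have "norm (Y x) = norm x \<longleftrightarrow> (norm x)\<^sup>2 - (norm (Y x))\<^sup>2 = 0"
    by (auto simp: power2_eq_iff_nonneg)
  also have "\<dots> \<longleftrightarrow> f \<in> S"
    unfolding f(2) norm_Y[OF f(1)] using Im_mu f(1) by (simp add: hermitian_domain_def)
  also have "\<dots> \<longleftrightarrow> x \<in> R"
    using f inj_onD[OF inj_A] hermitian_mem by blast
  finally show ?thesis by blast
qed

lemma continuous_Y: "continuous_on X Y"
proof (rule continuous_on_subset[OF _ subset_UNIV])
  have "bounded_linear Y"
    by (rule bounded_linear_intro[where K = 1]) (simp_all add: Y_simps norm_Y_le)
  then show "continuous_on UNIV Y"
    by (intro linear_continuous_on)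
qed

lemma csubspace_R: "complex_vector.subspace R"
  by (rule csubspace_image[OF linear_shifted csubspace_hermitian]) (auto intro: hermitian_mem)

lemma closed_R: "closed R"
proof -
  have "R = {x. norm (Y x) = norm x}"
    using mem_R_iff by blast
  also have "closed \<dots>"
    by (intro closed_Collect_eq continuous_intros continuous_Y)
  finally show ?thesis .
qed

lemma N_eq: "N = corthogonal R"
  by (simp add: deficiency_subspace_def)

lemma mem_N_iff: "x \<in> N \<longleftrightarrow> (\<forall>s\<in>S. cinner x (A s) = 0)"
  by (auto simp: deficiency_subspace_def corthogonal_def)

lemma mem_N'_iff: "x \<in> N' \<longleftrightarrow> (\<forall>s\<in>S. cinner x (Y (A s)) = 0)"
  by (auto simp: deficiency_subspace_def corthogonal_def cayley_A hermitian_mem)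

lemma Y_mem_N': "x \<in> N \<Longrightarrow> Y x \<in> N'"
  by (simp add: mem_N_iff mem_N'_iff cinner_Y_hermitian)

lemma csubspace_N: "complex_vector.subspace N" "complex_vector.subspace N'"
  and closed_N: "closed N" "closed N'"
  by (simp_all add: deficiency_subspace_def csubspace_corthogonal closed_corthogonal)

lemma M_eq: "x \<in> N \<Longrightarrow> M x = Y x"
  by (simp add: M_op_def)

lemma contraction_M: "contraction_between N N' M"
proof -
  have "linear_operator N M"
    using csubspace_N(1)
    by (intro linear_operatorI) (simp_all add: M_eq Y_simps complex_vector.subspace_add
        complex_vector.subspace_scale)
  then show ?thesis
    by (auto simp: contraction_between_def M_eq Y_mem_N' norm_Y_le)
qed

sublocale M: contraction_pair N N' M
  by unfold_locales (simp_all add: contraction_M csubspace_N closed_N)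

lemma adjoint_adjoint_M: "cadjoint_on N' N M.Zs = M"
proof (rule extensionalityI[of _ N])
  show "cadjoint_on N' N M.Zs x = M x" if "x \<in> N" for x
    by (rule cadjoint_on_cadjoint[OF contraction_M closed_N(1) csubspace_N(2) that])
qed (simp_all add: cadjoint_on_def M_op_def)

text \<open>As \<open>R\<close> is a closed subspace, \<open>H = N \<oplus> R\<close>.\<close>

lemma N_decomposition: obtains s where "s \<in> S" "x = cproj N x + A s"
proof -
  let ?r = "cproj R x"
  note proj = cproj_mem[OF csubspace_R closed_R, of x] cproj_orthogonal[OF csubspace_R closed_R, of x]
  have "?r \<in> corthogonal N"
    using proj(1) unfolding corthogonal_def N_eq by (auto, metis cinner_commute complex_cnj_zero)
  then have "cproj N x = x - ?r"
    using proj(2) by (intro cproj_eqI[OF csubspace_N(1)]) (simp_all add: N_eq)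
  then show thesis
    using proj(1) that by auto
qed

text \<open>The map \<open>x \<mapsto> D\<^sub>M P\<^sub>N x\<close> plays the role of \<open>D\<^sub>Y\<close>: since \<open>Y\<close> is isometric on \<open>R\<close>, its squared norm is
  \<open>\<parallel>x\<parallel>\<^sup>2 - \<parallel>Y x\<parallel>\<^sup>2\<close>, which measures \<open>Im (T f, f)\<close>.\<close>

lemma norm_defect_cproj:
  assumes f: "f \<in> D"
  shows "(norm (M.DZ (cproj N (A f))))\<^sup>2 = 4 * Im \<mu> * Im (cinner (T f) f)"
proof -
  define x where "x = A f"
  define n where "n = cproj N x"
  have n: "n \<in> N"
    unfolding n_def by (rule cproj_mem[OF csubspace_N(1) closed_N(1)])
  obtain s where s: "s \<in> S" "x = n + A s"
    unfolding n_def by (rule N_decomposition)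
  have "cinner n (A s) = 0"
    using n s(1) by (simp add: mem_N_iff)
  then have "orthogonal n (A s)" "orthogonal (Y n) (Y (A s))"
    using cinner_Y_hermitian[OF s(1), of n] by (simp_all add: orthogonal_def inner_eq_Re_cinner)
  then have "(norm x)\<^sup>2 = (norm n)\<^sup>2 + (norm (A s))\<^sup>2"
    "(norm (Y x))\<^sup>2 = (norm (Y n))\<^sup>2 + (norm (Y (A s)))\<^sup>2"
    by (simp_all add: s(2) Y_add norm_add_Pythagorean)
  moreover have "norm (Y (A s)) = norm (A s)"
    using s(1) mem_R_iff by blast
  ultimately have "(norm x)\<^sup>2 - (norm (Y x))\<^sup>2 = (norm n)\<^sup>2 - (norm (M n))\<^sup>2"
    using n by (simp add: M_eq)
  then show ?thesis
    using norm_Y[OF f] M.norm_defect[OF n] by (simp add: x_def n_def)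
qed

lemma mem_L_iff: "u \<in> L \<longleftrightarrow> (\<forall>s\<in>S. cinner u s = 0)"
  by (simp add: corthogonal_def)

lemma mem_L_iff_left: "u \<in> L \<longleftrightarrow> (\<forall>s\<in>S. cinner s u = 0)"
  unfolding mem_L_iff by (metis cinner_commute complex_cnj_zero)

text \<open>The operator \<open>P\<^sub>N - M\<^sup>* P\<^sub>N\<^sub>'\<close> gives the component of \<open>(I - Y)\<^sup>*\<close> in \<open>N\<close>.\<close>

definition adj_part :: "'a \<Rightarrow> 'a" where
  "adj_part u = cproj N u - M.Zs (cproj N' u)"

lemma adj_part_mem: "adj_part u \<in> N"
  unfolding adj_part_def
  by (intro complex_vector.subspace_diff[OF csubspace_N(1)] M.Zs_mem cproj_mem csubspace_N closed_N)

text \<open>On \<open>L\<close> there is no component in \<open>R\<close> to lose, because \<open>(I - Y) R = S\<close> is orthogonal to \<open>L\<close>; there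
  \<open>adj_part\<close> is all of \<open>(I - Y)\<^sup>*\<close>.\<close>

lemma cinner_adj_part:
  assumes u: "u \<in> L"
  shows "cinner (x - Y x) u = cinner x (adj_part u)"
proof -
  obtain s where s: "s \<in> S" and x: "x = cproj N x + A s"
    by (rule N_decomposition)
  define n where "n = cproj N x"
  have n: "n \<in> N"
    unfolding n_def by (rule cproj_mem[OF csubspace_N(1) closed_N(1)])
  have "cinner (A s - Y (A s)) u = 0"
    using u s by (simp add: id_minus_Y hermitian_mem cinner_scaleC_left mem_L_iff_left)
  moreover have "cinner (A s) (adj_part u) = 0"
    using adj_part_mem[of u] s unfolding mem_N_iff by (metis cinner_commute complex_cnj_zero)
  moreover have "cinner (n - Y n) u = cinner n (adj_part u)"
  proof -
    have "cinner n (M.Zs (cproj N' u)) = cinner (M n) (cproj N' u)"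
      by (intro M.adjoint[symmetric] cproj_mem csubspace_N closed_N n)
    also have "\<dots> = cinner (Y n) u"
      by (simp add: M_eq[OF n] cproj_cinner csubspace_N closed_N Y_mem_N'[OF n])
    finally show ?thesis
      by (simp add: adj_part_def cinner_diff_left cinner_diff_right cproj_cinner csubspace_N
          closed_N n)
  qed
  moreover have "x - Y x = (n - Y n) + (A s - Y (A s))"
    by (subst (1 2) x) (simp add: n_def Y_add)
  moreover have "cinner x (adj_part u) = cinner n (adj_part u) + cinner (A s) (adj_part u)"
    by (subst x) (simp add: n_def cinner_add_left)
  ultimately show ?thesis
    by (simp add: cinner_add_left)
qed

text \<open>Likewise \<open>I - Y\<close> maps \<open>L\<close> into \<open>N'\<close>: on \<open>L\<close>, the product \<open>(u - Y u, Y r) = (u, Y r - r)\<close> with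
  \<open>r \<in> R\<close> vanishes. The two sides of the equation differ by \<open>u - P\<^sub>N\<^sub>' u\<close> and by \<open>Y r\<close>, where \<open>r = u - P\<^sub>N u\<close>;
  both are orthogonal to \<open>N'\<close>.\<close>

lemma id_minus_Y_on_L:
  assumes u: "u \<in> L"
  shows "u - Y u = cproj N' u - M (cproj N u)"
proof -
  obtain s where s: "s \<in> S" and u_eq: "u = cproj N u + A s"
    by (rule N_decomposition)
  define a where "a = cproj N u"
  have a: "a \<in> N"
    unfolding a_def by (rule cproj_mem[OF csubspace_N(1) closed_N(1)])
  have Yu: "Y u = Y a + Y (A s)"
    by (subst u_eq) (simp add: a_def Y_add)
  define d where "d = (u - Y u) - (cproj N' u - M a)"
  have "u - Y u \<in> N'"
    unfolding mem_N'_iff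
  proof
    fix t assume t: "t \<in> S"
    have "cinner (u - Y u) (Y (A t)) = - cinner u (A t - Y (A t))"
      by (simp add: cinner_diff_left cinner_diff_right cinner_Y_hermitian t)
    also have "\<dots> = 0"
      using u t by (simp add: id_minus_Y hermitian_mem cinner_scaleC_right mem_L_iff)
    finally show "cinner (u - Y u) (Y (A t)) = 0" .
  qed
  moreover have "cproj N' u - M a \<in> N'"
    by (intro complex_vector.subspace_diff[OF csubspace_N(2)] M.Z_mem a cproj_mem csubspace_N closed_N)
  ultimately have "d \<in> N'"
    unfolding d_def by (rule complex_vector.subspace_diff[OF csubspace_N(2)])
  moreover have "d \<in> corthogonal N'"
    unfolding corthogonal_def
  proof (intro CollectI ballI)
    fix y assume y: "y \<in> N'"
    have "cinner (Y (A s)) y = 0"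
      using y s unfolding mem_N'_iff by (metis cinner_commute complex_cnj_zero)
    then show "cinner d y = 0"
      by (simp add: d_def Yu cinner_diff_left cinner_add_left M_eq[OF a] cproj_cinner csubspace_N
          closed_N y)
  qed
  ultimately have "d = 0"
    by (rule corthogonal_self)
  then show ?thesis
    by (simp add: d_def a_def)
qed

lemma adj_part_eq_0:
  assumes "u \<in> L" "adj_part u = 0"
  shows "u = 0"
proof (rule eq_zero_if_orthogonal_domain)
  fix f assume f: "f \<in> D"
  have "(\<mu> - cnj \<mu>) * cinner f u = cinner (A f - Y (A f)) u"
    by (simp add: id_minus_Y f cinner_scaleC_left)
  also have "\<dots> = 0"
    using cinner_adj_part[OF assms(1)] assms(2) by simp
  finally show "cinner f u = 0"
    using mu_nonreal by simp
qed

lemma id_minus_Y_eq_0: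
  assumes "u - Y u = 0"
  shows "u = 0"
proof -
  obtain f where f: "f \<in> D" "u = A f" by (rule A_surj)
  then have "f = 0"
    using assms id_minus_Y[OF f(1)] mu_nonreal by simp
  then show ?thesis
    using f linear_operator_zero[OF linear_T] by simp
qed

text \<open>Let \<open>s n \<rightarrow> f\<close> be a sequence as in the definition of singularity. In terms of \<open>x n = (T - cnj \<mu>) (s n)\<close>
  the decay of the form says \<open>D\<^sub>M P\<^sub>N (x n) \<rightarrow> 0\<close>, and \<open>(s n, u)\<close> is a multiple of \<open>(P\<^sub>N (x n), adj_part u)\<close>. If the
  former forces the latter to tend to \<open>0\<close>, then \<open>u\<close> is orthogonal to every \<open>f\<close> in the domain.\<close>

lemma D_sing_test:
  assumes sing: "D_sing D T" and u: "u \<in> L"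
    and null: "\<And>s. (\<And>n. s n \<in> D) \<Longrightarrow> (\<lambda>n. M.DZ (cproj N (A (s n)))) \<longlonglongrightarrow> 0
      \<Longrightarrow> (\<lambda>n. cinner (cproj N (A (s n))) (adj_part u)) \<longlonglongrightarrow> 0"
  shows "u = 0"
proof (rule eq_zero_if_orthogonal_domain)
  fix f assume "f \<in> D"
  then obtain s where s: "\<And>n. s n \<in> D" "s \<longlonglongrightarrow> f" "(\<lambda>n. Im (cinner (T (s n)) (s n))) \<longlonglongrightarrow> 0"
    using sing unfolding D_sing_iff by blast
  have "(\<lambda>n. 4 * Im \<mu> * Im (cinner (T (s n)) (s n))) \<longlonglongrightarrow> 0"
    by (intro tendsto_mult_right_zero s)
  then have "(\<lambda>n. (norm (M.DZ (cproj N (A (s n)))))\<^sup>2) \<longlonglongrightarrow> 0"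
    by (simp add: norm_defect_cproj s(1))
  then have "(\<lambda>n. M.DZ (cproj N (A (s n)))) \<longlonglongrightarrow> 0"
    by (rule tendsto_zero_if_norm_square)
  with null s(1) have "(\<lambda>n. cinner (cproj N (A (s n))) (adj_part u)) \<longlonglongrightarrow> 0"
    by blast
  also have "(\<lambda>n. cinner (cproj N (A (s n))) (adj_part u)) = (\<lambda>n. (\<mu> - cnj \<mu>) * cinner (s n) u)"
  proof
    fix n
    have "cinner (cproj N (A (s n))) (adj_part u) = cinner (A (s n)) (adj_part u)"
      by (rule cproj_cinner[OF csubspace_N(1) closed_N(1) adj_part_mem])
    also have "\<dots> = (\<mu> - cnj \<mu>) * cinner (s n) u"
      by (simp add: cinner_scaleC_left id_minus_Y s(1) flip: cinner_adj_part[OF u])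
    finally show "cinner (cproj N (A (s n))) (adj_part u) = (\<mu> - cnj \<mu>) * cinner (s n) u" .
  qed
  finally have "(\<lambda>n. (\<mu> - cnj \<mu>) * cinner (s n) u) \<longlonglongrightarrow> 0" .
  moreover have "(\<lambda>n. (\<mu> - cnj \<mu>) * cinner (s n) u) \<longlonglongrightarrow> (\<mu> - cnj \<mu>) * cinner f u"
    by (intro tendsto_intros s)
  ultimately have "(\<mu> - cnj \<mu>) * cinner f u = 0"
    using LIMSEQ_unique by blast
  then show "cinner f u = 0"
    using mu_nonreal by simp
qed

lemma closure_hermitian_if_L_trivial:
  assumes "\<And>u. u \<in> L \<Longrightarrow> u = 0"
  shows "closure S = UNIV"
proof -
  have "p \<in> closure S" for p
  proof (rule mem_closure_if_orthogonal[OF csubspace_imp_subspace[OF csubspace_hermitian]])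
    fix w assume w: "\<And>x. x \<in> S \<Longrightarrow> inner x w = 0"
    have "cinner s w = cinner s 0" if "s \<in> S" for s
      using cinner_eq_if_inner_eq[OF csubspace_hermitian linear_operator_id[OF csubspace_hermitian],
          of w 0 s] w that by simp
    then have "w \<in> L"
      by (simp add: mem_L_iff_left)
    from assms[OF this] show "inner p w = 0"
      by simp
  qed
  then show ?thesis by blast
qed

text \<open>Singularity says that the closure of the graph \<open>{((I - Y) x, D\<^sub>M P\<^sub>N x)}\<close> in the product space
  contains \<open>(f, 0)\<close> for every \<open>f\<close> in the domain; here \<open>f\<close> is a multiple of \<open>(I - Y) (T - cnj \<mu>) f\<close>.
  A pair \<open>(u, v)\<close> is orthogonal to this graph exactly when \<open>u \<in> L\<close> and \<open>(P\<^sub>N - M\<^sup>* P\<^sub>N\<^sub>') u = - D\<^sub>M P\<^sub>N v\<close>; if that only happens for \<open>u = 0\<close>, then every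
  \<open>(f, 0)\<close> is orthogonal to the orthogonal complement of the graph and hence in its closure.
  Conversely, if \<open>adj_part u = D\<^sub>M v\<close>, then \<open>(P\<^sub>N x, adj_part u) = (D\<^sub>M P\<^sub>N x, v)\<close>.\<close>

lemma D_sing_iff_defect_range:
  "D_sing D T \<longleftrightarrow> (\<forall>u\<in>L. adj_part u \<in> M.DZ ` N \<longrightarrow> u = 0)"
proof
  assume sing: "D_sing D T"
  show "\<forall>u\<in>L. adj_part u \<in> M.DZ ` N \<longrightarrow> u = 0"
  proof (intro ballI impI)
    fix u assume u: "u \<in> L" and "adj_part u \<in> M.DZ ` N"
    then obtain v where v: "v \<in> N" "adj_part u = M.DZ v" by blast
    show "u = 0"
    proof (rule D_sing_test[OF sing u])
      fix s assume lim: "(\<lambda>n. M.DZ (cproj N (A (s n)))) \<longlonglongrightarrow> 0"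
      have "cinner (cproj N (A (s n))) (adj_part u) = cinner (M.DZ (cproj N (A (s n)))) v" for n
        unfolding v(2)
        by (intro M.symmetric_defect[symmetric] cproj_mem csubspace_N closed_N v(1))
      moreover have "(\<lambda>n. cinner (M.DZ (cproj N (A (s n)))) v) \<longlonglongrightarrow> cinner 0 v"
        by (intro tendsto_intros lim)
      ultimately show "(\<lambda>n. cinner (cproj N (A (s n))) (adj_part u)) \<longlonglongrightarrow> 0"
        by simp
    qed
  qed
next
  assume trivial: "\<forall>u\<in>L. adj_part u \<in> M.DZ ` N \<longrightarrow> u = 0"
  define E where "E x = M.DZ (cproj N x)" for x
  have proj_mem: "cproj N x \<in> N" for x
    by (rule cproj_mem[OF csubspace_N(1) closed_N(1)])
  note linP = linear_operatorD[OF linear_operator_cproj[OF csubspace_N(1) closed_N(1)], simplified]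
    and linD = linear_operatorD[OF M.linear_defect]
  have E_simps: "E (x + y) = E x + E y" "E (r *\<^sub>R x) = r *\<^sub>R E x" for x y r
    unfolding E_def by (simp_all add: linP linD proj_mem)
  define G where "G = range (\<lambda>x. (x - Y x, E x))"
  have "subspace G"
  proof (rule subspaceI)
    have "E 0 = 0" "Y 0 = 0" using E_simps(2)[of 0 0] Y_simps(3)[of 0 0] by simp_all
    then show "0 \<in> G"
      unfolding G_def by (intro range_eqI[of _ _ 0]) (simp add: zero_prod_def)
    show "p + q \<in> G" if pq: "p \<in> G" "q \<in> G" for p q
    proof -
      obtain x y where "p = (x - Y x, E x)" "q = (y - Y y, E y)"
        using pq unfolding G_def by blast
      then have "p + q = ((x + y) - Y (x + y), E (x + y))"
        by (simp add: E_simps Y_add)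
      then show ?thesis
        unfolding G_def by blast
    qed
    show "r *\<^sub>R p \<in> G" if p: "p \<in> G" for r p
    proof -
      obtain x where "p = (x - Y x, E x)"
        using p unfolding G_def by blast
      then have "r *\<^sub>R p = (r *\<^sub>R x - Y (r *\<^sub>R x), E (r *\<^sub>R x))"
        by (simp add: E_simps Y_simps scaleR_diff_right)
      then show ?thesis
        unfolding G_def by blast
    qed
  qed
  have u_zero: "u = 0" if orth: "\<And>x. inner (x - Y x) u + inner (E x) v = 0" for u v
  proof -
    \<comment> \<open>Testing with \<open>x \<in> R\<close>, where \<open>E\<close> vanishes, gives \<open>u \<in> L\<close>.\<close>
    have "inner s u = 0" if s: "s \<in> S" for s
    proof -
      define t where "t = inverse (\<mu> - cnj \<mu>) *\<^sub>C s"
      have t: "t \<in> S"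
        unfolding t_def using csubspace_hermitian s by (rule complex_vector.subspace_scale)
      have "(norm (E (A t)))\<^sup>2 = 0"
        using norm_defect_cproj[OF hermitian_mem[OF t]] t by (simp add: E_def hermitian_domain_def)
      then have "inner (A t - Y (A t)) u = 0"
        using orth[of "A t"] by simp
      then show ?thesis
        using mu_nonreal by (simp add: id_minus_Y hermitian_mem[OF t]) (simp add: t_def scaleC_scaleC)
    qed
    then have "cinner s u = cinner s 0" if "s \<in> S" for s
      using cinner_eq_if_inner_eq[OF csubspace_hermitian linear_operator_id[OF csubspace_hermitian],
          of u 0 s] that by simp
    then have u: "u \<in> L"
      by (simp add: mem_L_iff_left)
    define v' where "v' = cproj N v"
    \<comment> \<open>Testing with this element of \<open>N\<close> itself gives \<open>\<parallel>z\<parallel>\<^sup>2 = 0\<close>.\<close>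
    define z where "z = adj_part u + M.DZ v'"
    have v': "v' \<in> N" unfolding v'_def by (rule proj_mem)
    have z: "z \<in> N"
      unfolding z_def by (intro complex_vector.subspace_add[OF csubspace_N(1)] adj_part_mem M.defect_mem v')
    have "inner (z - Y z) u = inner z (adj_part u)"
      using cinner_adj_part[OF u, of z] by (simp add: inner_eq_Re_cinner)
    moreover have "cproj N z = z"
      by (rule cproj_eqI[OF csubspace_N(1) z]) (simp add: corthogonal_def)
    moreover have "cinner (M.DZ z) v = cinner z (M.DZ v')"
      using M.symmetric_defect[OF z v'] cproj_cinner(2)[OF csubspace_N(1) closed_N(1) M.defect_mem[OF z], of v]
      by (simp add: v'_def)
    ultimately have "inner z z = 0"
      using orth[of z] unfolding E_def z_def[symmetric]
      by (subst (2) z_def) (simp add: cinner_add_right inner_eq_Re_cinner)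
    then have "adj_part u = - M.DZ v'"
      by (simp add: z_def eq_neg_iff_add_eq_0)
    also have "\<dots> = M.DZ ((- 1) *\<^sub>C v')"
      using linD(3)[OF v', of "-1"] by simp
    finally have "adj_part u \<in> M.DZ ` N"
      using complex_vector.subspace_scale[OF csubspace_N(1) v', of "-1"] by blast
    with trivial u show "u = 0" by blast
  qed
  show "D_sing D T"
    unfolding D_sing_iff
  proof
    fix f assume f: "f \<in> D"
    have "(A f - Y (A f), 0) \<in> closure G"
    proof (rule mem_closure_if_orthogonal[OF \<open>subspace G\<close>])
      fix w :: "'a \<times> 'a" assume w: "\<And>p. p \<in> G \<Longrightarrow> inner p w = 0"
      have "inner (x - Y x) (fst w) + inner (E x) (snd w) = 0" for x
        using w[of "(x - Y x, E x)"] by (simp add: G_def inner_prod_def)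
      then have "fst w = 0" by (rule u_zero)
      then show "inner (A f - Y (A f), 0) w = 0"
        by (simp add: inner_prod_def)
    qed
    then obtain p where p: "\<forall>n. p n \<in> G" "p \<longlonglongrightarrow> (A f - Y (A f), 0)"
      unfolding closure_sequential by blast
    have "\<exists>g\<in>D. p n = (A g - Y (A g), E (A g))" for n
    proof -
      obtain x where "p n = (x - Y x, E x)"
        using p(1) unfolding G_def by blast
      then show ?thesis
        using A_surj[of x] by metis
    qed
    then obtain s where s: "\<And>n. s n \<in> D" "\<And>n. p n = (A (s n) - Y (A (s n)), E (A (s n)))"
      by metis
    have "(\<lambda>n. (\<mu> - cnj \<mu>) *\<^sub>C s n) \<longlonglongrightarrow> (\<mu> - cnj \<mu>) *\<^sub>C f"
      using tendsto_fst[OF p(2)] by (simp add: s id_minus_Y f)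
    then have lim: "(\<lambda>n. inverse (\<mu> - cnj \<mu>) *\<^sub>C (\<mu> - cnj \<mu>) *\<^sub>C s n)
        \<longlonglongrightarrow> inverse (\<mu> - cnj \<mu>) *\<^sub>C (\<mu> - cnj \<mu>) *\<^sub>C f"
      by (rule tendsto_scaleC[OF tendsto_const])
    have cancel: "inverse (\<mu> - cnj \<mu>) *\<^sub>C (\<mu> - cnj \<mu>) *\<^sub>C x = x" for x :: 'a
      using mu_nonreal by (simp add: scaleC_scaleC)
    have "s \<longlonglongrightarrow> f"
      using lim by (simp only: cancel)
    moreover have "(\<lambda>n. Im (cinner (T (s n)) (s n))) \<longlonglongrightarrow> 0"
    proof -
      have "(\<lambda>n. E (A (s n))) \<longlonglongrightarrow> 0"
        using tendsto_snd[OF p(2)] by (simp add: s(2))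
      then have "(\<lambda>n. (norm (E (A (s n))))\<^sup>2 / (4 * Im \<mu>)) \<longlonglongrightarrow> (norm (0::'a))\<^sup>2 / (4 * Im \<mu>)"
        using Im_mu by (intro tendsto_intros) auto
      then show ?thesis
        using Im_mu by (simp add: E_def norm_defect_cproj s(1))
    qed
    ultimately show "\<exists>s. (\<forall>n. s n \<in> D) \<and> s \<longlonglongrightarrow> f \<and> (\<lambda>n. Im (cinner (T (s n)) (s n))) \<longlonglongrightarrow> 0"
      using s(1) by blast
  qed
qed

text \<open>Both directions are instances of the transfer between \<open>M\<close> and \<open>M\<^sup>*\<close>, because \<open>M\<^sup>*\<^sup>* = M\<close>.\<close>

lemma defect_range_iff:
  assumes "u \<in> L"
  shows "adj_part u \<in> M.DZ ` N
    \<longleftrightarrow> cproj N' u - M (cproj N u) \<in> defect_operator N' N M.Zs ` N'"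
proof
  interpret M': contraction_pair N' N M.Zs by (rule M.adjoint_pair)
  have mem: "cproj N u \<in> N" "cproj N' u \<in> N'"
    by (intro cproj_mem csubspace_N closed_N)+
  show "cproj N' u - M (cproj N u) \<in> M'.DZ ` N'" if "adj_part u \<in> M.DZ ` N"
    using M.defect_range_transfer[OF mem] that by (simp add: adj_part_def)
  show "adj_part u \<in> M.DZ ` N" if "cproj N' u - M (cproj N u) \<in> M'.DZ ` N'"
    using M'.defect_range_transfer[OF mem(2,1)] that by (simp add: adj_part_def adjoint_adjoint_M)
qed

lemma inter_image_eq_zero_iff:
  fixes V :: "'a set"
  assumes "0 \<in> V" "0 \<in> L" "F 0 = 0" and inj: "\<And>u. u \<in> L \<Longrightarrow> F u = 0 \<Longrightarrow> u = 0"
  shows "V \<inter> F ` L = {0} \<longleftrightarrow> (\<forall>u\<in>L. F u \<in> V \<longrightarrow> u = 0)"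
  using assms by (auto simp: set_eq_iff)

lemma D_sing_iff_inter_ranges:
  "D_sing D T \<longleftrightarrow> M.DZ ` N \<inter> (\<lambda>f. cproj N f - M.Zs (cproj N' f)) ` L = {0}"
  "D_sing D T \<longleftrightarrow> defect_operator N' N M.Zs ` N' \<inter> (\<lambda>f. cproj N' f - M (cproj N f)) ` L = {0}"
proof -
  interpret M': contraction_pair N' N M.Zs by (rule M.adjoint_pair)
  have L: "0 \<in> L" by (simp add: mem_L_iff)
  have zero: "0 \<in> M.DZ ` N" "0 \<in> M'.DZ ` N'"
    using linear_operator_zero[OF M.linear_defect] linear_operator_zero[OF M'.linear_defect]
      complex_vector.subspace_0[OF csubspace_N(1)] complex_vector.subspace_0[OF csubspace_N(2)]
    by (metis image_eqI)+
  have F0: "cproj N 0 = 0" "cproj N' 0 = 0" "M 0 = 0" "M.Zs 0 = 0"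
    using linear_operator_zero[OF linear_operator_cproj[OF csubspace_N(1) closed_N(1)]]
      linear_operator_zero[OF linear_operator_cproj[OF csubspace_N(2) closed_N(2)]]
      linear_operator_zero[OF M.linear_Z] linear_operator_zero[OF M.linear_Zs] by simp_all
  have inj: "u = 0" if "u \<in> L" "cproj N' u - M (cproj N u) = 0" for u
    by (rule id_minus_Y_eq_0[OF trans[OF id_minus_Y_on_L[OF that(1)] that(2)]])
  have "M.DZ ` N \<inter> adj_part ` L = {0} \<longleftrightarrow> (\<forall>u\<in>L. adj_part u \<in> M.DZ ` N \<longrightarrow> u = 0)"
  proof (rule inter_image_eq_zero_iff[OF zero(1) L])
    show "adj_part 0 = 0" by (simp add: adj_part_def F0)
  qed (rule adj_part_eq_0)
  then show "D_sing D T \<longleftrightarrow> M.DZ ` N \<inter> (\<lambda>f. cproj N f - M.Zs (cproj N' f)) ` L = {0}"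
    unfolding D_sing_iff_defect_range adj_part_def[abs_def] by blast
  have "M'.DZ ` N' \<inter> (\<lambda>f. cproj N' f - M (cproj N f)) ` L = {0} \<longleftrightarrow>
      (\<forall>u\<in>L. cproj N' u - M (cproj N u) \<in> M'.DZ ` N' \<longrightarrow> u = 0)"
  proof (rule inter_image_eq_zero_iff[OF zero(2) L])
    show "cproj N' 0 - M (cproj N 0) = 0" by (simp add: F0)
  qed (rule inj)
  then show "D_sing D T \<longleftrightarrow> M'.DZ ` N' \<inter> (\<lambda>f. cproj N' f - M (cproj N f)) ` L = {0}"
    unfolding D_sing_iff_defect_range using defect_range_iff by blast
qed

end

section \<open>The norm of the contraction \<open>M\<close>\<close>

lemma bdd_above_op_norm:
  assumes "contraction_between K K' Z"
  shows "bdd_above ((\<lambda>x. norm (Z x)) ` {x \<in> K. norm x \<le> 1})"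
  using contraction_betweenD(4)[OF assms] by (intro bdd_aboveI2[where M = 1]) force

lemma norm_le_op_norm_on:
  assumes Z: "contraction_between K K' Z" and x: "x \<in> K"
  shows "norm (Z x) \<le> op_norm_on K Z * norm x"
proof (cases "x = 0")
  case True
  then show ?thesis
    using linear_operator_zero[OF contraction_betweenD(2)[OF Z]] by simp
next
  case False
  define y where "y = (1 / norm x) *\<^sub>R x"
  have y: "y \<in> K"
    unfolding y_def using csubspace_imp_subspace[OF contraction_betweenD(1)[OF Z]] x
    by (rule subspace_scale)
  have "norm (Z x) / norm x = norm (Z y)"
    by (simp add: y_def linear_operatorD(4)[OF contraction_betweenD(2)[OF Z] x])
  also have "\<dots> \<le> op_norm_on K Z"
    unfolding op_norm_on_def
    using y False by (intro cSUP_upper bdd_above_op_norm[OF Z]) (simp add: y_def)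
  finally show ?thesis
    using False by (simp add: divide_le_eq)
qed

text \<open>The balls are compact by induction on the spanning set: a new vector \<open>b\<close> may be replaced by
  its component \<open>e\<close> orthogonal to the old span \<open>V\<close>, and then \<open>y + c e\<close> with \<open>y \<in> V\<close> stays in a ball
  only if \<open>y\<close> and \<open>c\<close> do.\<close>

lemma compact_ball_span:
  fixes B :: "'a::chilbert_space set"
  assumes "finite B"
  shows "compact {x \<in> complex_vector.span B. norm x \<le> r}"
  using assms
proof (induction B arbitrary: r rule: finite_induct)
  case empty
  have "{x \<in> complex_vector.span {}. norm x \<le> r} \<subseteq> {0 :: 'a}"
    by auto
  then show ?case
    using finite_imp_compact finite_subset by blast
next
  case (insert b B)
  define V where "V = complex_vector.span B"
  have V: "complex_vector.subspace V"
    unfolding V_def by (rule complex_vector.subspace_span)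
  have ball: "compact {x \<in> V. norm x \<le> r}" for r
    unfolding V_def by (rule insert.IH)
  have "closed V"
    unfolding closed_sequential_limits
  proof (intro allI impI)
    fix s l assume s: "(\<forall>n. s n \<in> V) \<and> s \<longlonglongrightarrow> l"
    then obtain C where "\<And>n. norm (s n) \<le> C"
      using convergent_imp_Bseq[of s] convergent_def unfolding Bseq_def by blast
    then have "\<forall>n. s n \<in> {x \<in> V. norm x \<le> C}"
      using s by blast
    then have "l \<in> {x \<in> V. norm x \<le> C}"
      using s closed_sequentially[OF compact_imp_closed[OF ball]] by blast
    then show "l \<in> V" by blast
  qed
  note P = cproj_mem[OF V this] cproj_orthogonal[OF V this]
  define e where "e = b - cproj V b"
  have e_orth: "orthogonal y (c *\<^sub>C e)" if "y \<in> V" for y c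
  proof -
    have "cinner e y = 0"
      using P(2)[of b] that by (simp add: e_def corthogonal_def)
    then have "cinner y e = 0"
      by (metis cinner_commute complex_cnj_zero)
    then show ?thesis
      by (simp add: orthogonal_def inner_eq_Re_cinner cinner_scaleC_right)
  qed
  define W where "W = complex_vector.span (insert b B)"
  have W: "complex_vector.subspace W"
    unfolding W_def by (rule complex_vector.subspace_span)
  have VW: "V \<subseteq> W"
    unfolding V_def W_def by (intro complex_vector.span_mono) blast
  have "b \<in> W"
    unfolding W_def by (intro complex_vector.span_base) blast
  then have "e \<in> W"
    unfolding e_def using VW P(1) by (intro complex_vector.subspace_diff[OF W]) blast+
  define F where "F p = fst p + snd p *\<^sub>C e" for p
  define Q where "Q = {x \<in> V. norm x \<le> r} \<times> cball (0::complex) (r / norm e)"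
  have "{x \<in> W. norm x \<le> r} = F ` Q \<inter> cball 0 r"
  proof (intro equalityI subsetI)
    fix x assume "x \<in> F ` Q \<inter> cball 0 r"
    then show "x \<in> {x \<in> W. norm x \<le> r}"
      using VW complex_vector.subspace_add[OF W] complex_vector.subspace_scale[OF W \<open>e \<in> W\<close>]
      by (auto simp: F_def Q_def)
  next
    fix x assume x: "x \<in> {x \<in> W. norm x \<le> r}"
    then obtain k where k: "x - k *\<^sub>C b \<in> V"
      unfolding W_def V_def complex_vector.span_insert by blast
    define y where "y = (x - k *\<^sub>C b) + k *\<^sub>C cproj V b"
    have y: "y \<in> V"
      unfolding y_def
      by (intro complex_vector.subspace_add[OF V] complex_vector.subspace_scale[OF V] P k)
    \<comment> \<open>If \<open>b \<in> V\<close>, then \<open>k\<close> is arbitrary; the coefficient \<open>0\<close> fits the radius \<open>r / norm e = 0\<close>.\<close>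
    define c where "c = (if e = 0 then 0 else k)"
    have x_eq: "x = y + c *\<^sub>C e"
      by (auto simp: y_def c_def e_def complex_vector.scale_right_diff_distrib)
    have "(norm x)\<^sup>2 = (norm y)\<^sup>2 + (norm (c *\<^sub>C e))\<^sup>2"
      unfolding x_eq using e_orth[OF y] by (rule norm_add_Pythagorean)
    moreover have "(norm x)\<^sup>2 \<le> r\<^sup>2" "0 \<le> r"
      using x norm_ge_zero[of x] by (auto intro: power_mono order_trans simp del: norm_ge_zero)
    ultimately have "(norm y)\<^sup>2 \<le> r\<^sup>2" "(norm (c *\<^sub>C e))\<^sup>2 \<le> r\<^sup>2"
      using zero_le_power2[of "norm y"] zero_le_power2[of "norm (c *\<^sub>C e)"] by linarith+
    then have "norm y \<le> r" "norm (c *\<^sub>C e) \<le> r"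
      using \<open>0 \<le> r\<close> power2_le_imp_le by blast+
    then have "norm c \<le> r / norm e"
      by (cases "e = 0") (simp_all add: c_def norm_scaleC pos_le_divide_eq)
    then have "(y, c) \<in> Q"
      using y \<open>norm y \<le> r\<close> by (simp add: Q_def)
    then show "x \<in> F ` Q \<inter> cball 0 r"
      using x x_eq by (auto simp: F_def intro!: image_eqI[of _ _ "(y, c)"])
  qed
  moreover have "compact (F ` Q)"
    unfolding F_def Q_def
    by (intro compact_continuous_image continuous_intros compact_Times ball compact_cball)
  ultimately show ?case
    unfolding W_def by (simp add: compact_Int_closed)
qed

context cayley_transform
begin

text \<open>If \<open>\<parallel>M\<parallel> < 1\<close>, then \<open>D\<^sub>M\<close> is bounded below, so \<open>D\<^sub>M P\<^sub>N x\<^sub>n \<rightarrow> 0\<close> forces \<open>P\<^sub>N x\<^sub>n \<rightarrow> 0\<close> and the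
  test is passed by every \<open>u \<in> L\<close>.\<close>

lemma hermitian_dense_if_strict_contraction:
  assumes sing: "D_sing D T" and norm: "op_norm_on N M < 1"
  shows "closure S = UNIV"
proof (rule closure_hermitian_if_L_trivial)
  fix u assume u: "u \<in> L"
  define q where "q = max 0 (op_norm_on N M)"
  have q: "0 \<le> q" "q < 1" "q\<^sup>2 < 1"
    using norm by (auto simp: q_def max_def power_less_one_iff abs_square_less_1)
  have below: "(1 - q\<^sup>2) * (norm n)\<^sup>2 \<le> (norm (M.DZ n))\<^sup>2" if n: "n \<in> N" for n
  proof -
    have "norm (M n) \<le> op_norm_on N M * norm n"
      by (rule norm_le_op_norm_on[OF contraction_M n])
    also have "\<dots> \<le> q * norm n"
      by (intro mult_right_mono) (simp_all add: q_def)
    finally have "(norm (M n))\<^sup>2 \<le> (q * norm n)\<^sup>2"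
      by (rule power_mono) simp
    then show ?thesis
      by (simp add: M.norm_defect[OF n] power_mult_distrib algebra_simps)
  qed
  show "u = 0"
  proof (rule D_sing_test[OF sing u])
    fix s assume lim: "(\<lambda>n. M.DZ (cproj N (A (s n)))) \<longlonglongrightarrow> 0"
    have "(\<lambda>n. (norm (cproj N (A (s n))))\<^sup>2) \<longlonglongrightarrow> 0"
    proof (rule Lim_null_comparison[OF always_eventually])
      show "\<forall>n. norm ((norm (cproj N (A (s n))))\<^sup>2) \<le> (norm (M.DZ (cproj N (A (s n)))))\<^sup>2 / (1 - q\<^sup>2)"
        using below[OF cproj_mem[OF csubspace_N(1) closed_N(1)]] q
        by (simp add: pos_le_divide_eq mult.commute)
      have "(\<lambda>n. (norm (M.DZ (cproj N (A (s n)))))\<^sup>2 / (1 - q\<^sup>2)) \<longlonglongrightarrow> (norm (0::'a))\<^sup>2 / (1 - q\<^sup>2)"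
        using q by (intro tendsto_intros lim) auto
      then show "(\<lambda>n. (norm (M.DZ (cproj N (A (s n)))))\<^sup>2 / (1 - q\<^sup>2)) \<longlonglongrightarrow> 0"
        by simp
    qed
    then have "(\<lambda>n. cproj N (A (s n))) \<longlonglongrightarrow> 0"
      by (rule tendsto_zero_if_norm_square)
    then have "(\<lambda>n. cinner (cproj N (A (s n))) (adj_part u)) \<longlonglongrightarrow> cinner 0 (adj_part u)"
      by (intro tendsto_intros)
    then show "(\<lambda>n. cinner (cproj N (A (s n))) (adj_part u)) \<longlonglongrightarrow> 0"
      by simp
  qed
qed

text \<open>\<open>Y\<close> is isometric only on \<open>R = N\<^sup>\<bottom>\<close>, so \<open>M\<close> shrinks every nonzero vector strictly; on a compact
  ball the norm is attained.\<close>

lemma strict_contraction_if_finite_dim: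
  assumes "cfinite_dim N"
  shows "op_norm_on N M < 1"
proof -
  have strict: "norm (M x) < norm x" if x: "x \<in> N" "x \<noteq> 0" for x
  proof -
    have "x \<in> corthogonal R"
      using x(1) by (simp only: N_eq)
    then have "x \<notin> R"
      using corthogonal_self[of x R] x(2) by metis
    then show ?thesis
      using mem_R_iff[of x] norm_Y_le[of x] by (simp add: M_eq[OF x(1)])
  qed
  define C where "C = {x \<in> N. norm x \<le> 1}"
  obtain B where B: "finite B" "complex_vector.span B = N"
    using assms unfolding cfinite_dim_def by blast
  have "compact C"
    using compact_ball_span[OF B(1), of 1] by (simp only: B(2) C_def)
  moreover have "0 \<in> C"
    using complex_vector.subspace_0[OF csubspace_N(1)] by (simp add: C_def)
  moreover have "continuous_on C (\<lambda>x. norm (Y x))"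
    by (intro continuous_intros continuous_Y)
  ultimately obtain x where x: "x \<in> C" "\<And>y. y \<in> C \<Longrightarrow> norm (Y y) \<le> norm (Y x)"
    using continuous_attains_sup[of C "\<lambda>x. norm (Y x)"] by blast
  have "op_norm_on N M \<le> norm (Y x)"
    unfolding op_norm_on_def C_def[symmetric]
    using x(2) \<open>0 \<in> C\<close> by (intro cSUP_least) (auto simp: C_def M_eq)
  also have "\<dots> < 1"
  proof (cases "x = 0")
    case True
    then show ?thesis
      using linear_operator_zero[OF linear_Y] by simp
  next
    case False
    then show ?thesis
      using strict[of x] x(1) by (simp add: C_def M_eq)
  qed
  finally show ?thesis .
qed

end

theorem theorem4p5:
  fixes D :: "'a::chilbert_space set" and T :: "'a \<Rightarrow> 'a"
  assumes "maximal_dissipative D T" and "densely_defined D"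
  shows
    "(hermitian_domain D T \<noteq> {0} \<longrightarrow>
       (let L = corthogonal (hermitian_domain D T) in
        \<forall>\<mu>. Im \<mu> > 0 \<longrightarrow>
          (let N = deficiency_subspace D T \<mu>;
               N' = deficiency_subspace D T (cnj \<mu>);
               M = M_op D T \<mu>;
               Ms = cadjoint_on N N' M
           in contraction_between N N' M \<and>
              (D_sing D T \<longleftrightarrow>
                 defect_operator N' N Ms ` N' \<inter> (\<lambda>f. cproj N' f - M (cproj N f)) ` L = {0}) \<and>
              (D_sing D T \<longleftrightarrow>
                 defect_operator N N' M ` N \<inter> (\<lambda>f. cproj N f - Ms (cproj N' f)) ` L = {0}))))
     \<and> (closure (hermitian_domain D T) = UNIV \<longrightarrow> D_sing D T)
     \<and> (hermitian_domain D T \<noteq> {0} \<and> closure (hermitian_domain D T) \<noteq> UNIV \<longrightarrow>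
          ((\<exists>\<mu>. Im \<mu> > 0 \<and> op_norm_on (deficiency_subspace D T \<mu>) (M_op D T \<mu>) < 1)
             \<longrightarrow> \<not> D_sing D T) \<and>
          (\<forall>\<mu>. Im \<mu> > 0 \<and> cfinite_dim (deficiency_subspace D T \<mu>)
             \<longrightarrow> op_norm_on (deficiency_subspace D T \<mu>) (M_op D T \<mu>) < 1))
     \<and> (D_sing D T \<longrightarrow> hermitian_domain D T = D \<inter> adjoint_domain D T)"
proof -
  interpret dense_maximal_dissipative D T
    using assms by unfold_locales
  have cayley: "cayley_transform D T \<mu>" if "Im \<mu> > 0" for \<mu>
    using that by unfold_locales
  show ?thesis
    unfolding Let_def
  proof (intro conjI impI allI)
    fix \<mu> :: complex assume mu: "Im \<mu> > 0"
    interpret cayley_transform D T \<mu>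
      by (rule cayley[OF mu])
    show "contraction_between N N' M"
      by (rule contraction_M)
    show "D_sing D T \<longleftrightarrow>
        defect_operator N' N M.Zs ` N' \<inter> (\<lambda>f. cproj N' f - M (cproj N f)) ` L = {0}"
      by (rule D_sing_iff_inter_ranges(2))
    show "D_sing D T \<longleftrightarrow> M.DZ ` N \<inter> (\<lambda>f. cproj N f - M.Zs (cproj N' f)) ` L = {0}"
      by (rule D_sing_iff_inter_ranges(1))
  next
    assume "closure S = UNIV"
    then show "D_sing D T"
      by (rule D_sing_if_hermitian_dense)
  next
    assume "S \<noteq> {0} \<and> closure S \<noteq> UNIV"
      and "\<exists>\<mu>. Im \<mu> > 0 \<and> op_norm_on (deficiency_subspace D T \<mu>) (M_op D T \<mu>) < 1"
    then show "\<not> D_sing D T"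
      using cayley_transform.hermitian_dense_if_strict_contraction[OF cayley] by metis
  next
    fix \<mu> assume "Im \<mu> > 0 \<and> cfinite_dim (deficiency_subspace D T \<mu>)"
    then show "op_norm_on (deficiency_subspace D T \<mu>) (M_op D T \<mu>) < 1"
      using cayley_transform.strict_contraction_if_finite_dim[OF cayley] by metis
  next
    assume "D_sing D T"
    then show "S = D \<inter> adjoint_domain D T"
      by (rule hermitian_eq_if_D_sing)
  qed
qed

end
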